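(* Let $0<q<1$, let $\alpha,\beta>-1$ and $c\in\mathbb{R}$. Define rational functions in $t$ by $$p_n^{(\alpha,\beta)}(t;q,\mathrm{rat}):={}_2\phi_2\!\left(\begin{matrix}q^{-n},\,q^{n+\alpha+\beta+1}\\ q^{\alpha+1},\,-tq^{\beta+1}\end{matrix};q,-tq\right)\qquad(n\in\mathbb{Z}_{\ge0}),$$ and define a measure on $[0,\infty)$ by $$d\mu_{\alpha,\beta,c;q}(t):=\frac{q^{-c^2}\,\Gamma_q(c)\,\Gamma_q(1-c)\,\Gamma_q(\alpha+\beta+2)}{\Gamma(c)\,\Gamma(1-c)\,\Gamma_q(\alpha+1)\,\Gamma_q(\beta+1)}\;\frac{t^{c-1}\,(-tq^{\beta+1},-t^{-1}q^{\alpha+2};q)_\infty}{(-tq^{-c},-t^{-1}q^{1+c};q)_\infty}\,dt.$$ Then for all $n,m\in\mathbb{Z}_{\ge0}$, $$\int_0^\infty p_n^{(\alpha,\beta)}(t;q,\mathrm{rat})\;p_m^{(\beta,\alpha)}(t^{-1}q;q,\mathrm{rat})\;d\mu_{\alpha,\beta,c;q}(t)=\frac{(-1)^n\,(1-q^{n+\alpha+\beta+1})\,(q;q)_n\,\delta_{n,m}}{q^{\frac12 n(n-1)}\,(1-q^{2n+\alpha+\beta+1})\,(q^{\alpha+\beta+2};q)_n}.$$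
   Context: $q$-shifted factorials: for $k\in\mathbb{Z}_{\ge0}$, $(x;q)_k:=\prod_{j=0}^{k-1}(1-xq^j)$, $(x;q)_\infty:=\prod_{j=0}^{\infty}(1-xq^j)$, and $(x_1,\dots,x_r;q)_k:=\prod_{i=1}^r (x_i;q)_k$ for $k\in\mathbb{Z}_{\ge0}\cup\{\infty\}$. Basic hypergeometric series: $${}_2\phi_2\!\left(\begin{matrix}a_1,a_2\\ b_1,b_2\end{matrix};q,z\right):=\sum_{j\ge0}\frac{(a_1,a_2;q)_j}{(b_1,b_2,q;q)_j}\,(-1)^jq^{\frac12 j(j-1)}\,z^j,$$ which for $a_1=q^{-n}$ ($n\in\mathbb{Z}_{\ge0}$) is the finite sum over $0\le j\le n$. $\Gamma$ is the Euler gamma function and $\Gamma_q(z):=\dfrac{(q;q)_\infty}{(q^z;q)_\infty}(1-q)^{1-z}$ is the $q$-gamma function. For $c\in\mathbb{Z}$ the factor $\dfrac{\Gamma_q(c)\Gamma_q(1-c)}{\Gamma(c)\Gamma(1-c)}$ is understood by its continuous extension (removable singularity). For $n=0$ the quotient $\dfrac{1-q^{n+\alpha+\beta+1}}{1-q^{2n+\alpha+\beta+1}}$ is understood to be $1$, also when $\alpha+\beta+1=0$. $\delta_{n,m}$ is the Kronecker delta. *)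

theory Defs
  imports "HOL-Analysis.Analysis"
begin

definition qpoch :: "real \<Rightarrow> real \<Rightarrow> nat \<Rightarrow> real" where
  "qpoch x q k = (\<Prod>j<k. 1 - x * q ^ j)"

definition qpoch_inf :: "real \<Rightarrow> real \<Rightarrow> real" where
  "qpoch_inf x q = (\<Prod>j. 1 - x * q ^ j)"

definition phi_2_2 :: "real \<Rightarrow> real \<Rightarrow> real \<Rightarrow> real \<Rightarrow> real \<Rightarrow> real \<Rightarrow> real" where
  "phi_2_2 a1 a2 b1 b2 q z =
     (\<Sum>j. (qpoch a1 q j * qpoch a2 q j) / (qpoch b1 q j * qpoch b2 q j * qpoch q q j)
            * (-1) ^ j * q ^ (j * (j - 1) div 2) * z ^ j)"

definition Gamma_q :: "real \<Rightarrow> real \<Rightarrow> real" where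
  "Gamma_q q z = qpoch_inf q q / qpoch_inf (q powr z) q * (1 - q) powr (1 - z)"

definition p_rat :: "nat \<Rightarrow> real \<Rightarrow> real \<Rightarrow> real \<Rightarrow> real \<Rightarrow> real" where
  "p_rat n \<alpha> \<beta> t q =
     phi_2_2 (q powr (- real n)) (q powr (real n + \<alpha> + \<beta> + 1))
             (q powr (\<alpha> + 1)) (- t * q powr (\<beta> + 1)) q (- t * q)"

text \<open>At an integer \<open>c\<close> one of \<open>\<Gamma>(c)\<close>, \<open>\<Gamma>(1 - c)\<close> has a pole, and the same one of their
  \<open>q\<close>-analogues has one as well. The singularity of the quotient is removable, and the value there
  is the limit.\<close>

definition Gamma_quot :: "real \<Rightarrow> real \<Rightarrow> real" where
  "Gamma_quot q c =
     (let r = (\<lambda>x. (Gamma_q q x * Gamma_q q (1 - x)) / (Gamma x * Gamma (1 - x)))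
      in if c \<in> \<int> then Lim (at c) r else r c)"

definition mu_density :: "real \<Rightarrow> real \<Rightarrow> real \<Rightarrow> real \<Rightarrow> real \<Rightarrow> real" where
  "mu_density \<alpha> \<beta> c q t =
     q powr (- (c\<^sup>2)) * Gamma_quot q c * Gamma_q q (\<alpha> + \<beta> + 2)
       / (Gamma_q q (\<alpha> + 1) * Gamma_q q (\<beta> + 1))
     * (t powr (c - 1)
        * (qpoch_inf (- t * q powr (\<beta> + 1)) q * qpoch_inf (- (1 / t) * q powr (\<alpha> + 2)) q)
        / (qpoch_inf (- t * q powr (- c)) q * qpoch_inf (- (1 / t) * q powr (1 + c)) q))"

text \<open>For \<open>0 < q < 1\<close> and \<open>\<alpha>, \<beta> > -1\<close> the density is positive on \<open>t > 0\<close> (the quotient of Gamma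
  factors is positive for every real \<open>c\<close>), so the truncation of negative values by \<open>ennreal\<close> is
  not felt; the value at the null point \<open>t = 0\<close> is irrelevant.\<close>

definition mu_rat :: "real \<Rightarrow> real \<Rightarrow> real \<Rightarrow> real \<Rightarrow> real measure" where
  "mu_rat \<alpha> \<beta> c q =
     density (restrict_space lborel {0..}) (\<lambda>t. ennreal (mu_density \<alpha> \<beta> c q t))"

end

theory Submission
  imports Defs
begin

text \<open>
  Put \<open>w(t) = t\<^sup>c\<^sup>-\<^sup>1 / (-t q\<^sup>-\<^sup>c, -q\<^sup>1\<^sup>+\<^sup>c/t; q)\<^sub>\<infinity>\<close>. Quasi-periodicity of the theta function in the
  denominator gives \<open>q w(q t) = t w(t)\<close>, so the integer moments of \<open>w\<close> are
  \<open>\<mu>\<^sub>s = \<mu>\<^sub>0 q\<^bsup>-s(s-1)/2\<^esup>\<close>. Expanding both infinite products in the numerator by Euler's identity gives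
  a double series of positive terms, which may be integrated termwise; the Gaussian factors cancel
  and two applications of the \<open>q\<close>-binomial theorem yield
  \<open>\<integral> t\<^sup>s w(t) (-t q\<^sup>b, -q\<^bsup>a+1\<^esup>/t; q)\<^sub>\<infinity> dt = \<mu>\<^sub>0 q\<^bsup>-s(s-1)/2\<^esup> (q\<^bsup>a+b\<^esup>; q)\<^sub>\<infinity> / (q\<^bsup>a+s\<^esup>, q\<^bsup>b-s\<^esup>; q)\<^sub>\<infinity>\<close>.
  The mass \<open>\<mu>\<^sub>0\<close> is found from a choice of \<open>a, b\<close> that makes the integrand elementary: a beta integral
  for \<open>0 < c < 1\<close>, a partial fraction for \<open>c = 0\<close>, and other \<open>c\<close> by the shift \<open>c \<mapsto> c + 1\<close>.
  The denominators of the rational functions only shift \<open>a\<close> and \<open>b\<close>, so their pairing is a finite double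
  sum; the inner sum is a \<open>q\<close>-Chu--Vandermonde sum that vanishes unless \<open>j \<ge> m\<close>.
\<close>

section \<open>The \<open>q\<close>-binomial theorem\<close>

lemma qpoch_0 [simp]: "qpoch x q 0 = 1"
  by (simp add: qpoch_def)

lemma qpoch_Suc: "qpoch x q (Suc n) = qpoch x q n * (1 - x * q ^ n)"
  by (simp add: qpoch_def)

lemma qpoch_add: "qpoch x q (m + n) = qpoch x q m * qpoch (x * q ^ m) q n"
  by (induction n) (simp_all add: qpoch_Suc power_add mult_ac)

lemma qpoch_Suc_left: "qpoch x q (Suc n) = (1 - x) * qpoch (x * q) q n"
  using qpoch_add[of x q 1 n] by (simp add: qpoch_def)

lemma qpoch_eq_0: "j < n \<Longrightarrow> x * q ^ j = 1 \<Longrightarrow> qpoch x q n = 0"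
  by (auto simp: qpoch_def)

lemma qpoch_pos:
  assumes "0 < q" "q < 1" "x < 1"
  shows "0 < qpoch x q n"
  unfolding qpoch_def
proof (rule prod_pos)
  fix j
  have "x * q ^ j < 1"
  proof (cases "x \<le> 0")
    case True
    then show ?thesis using assms by (smt (verit) mult_nonpos_nonneg zero_le_power)
  next
    case False
    then have "x * q ^ j \<le> x * 1" using assms by (intro mult_left_mono power_le_one) auto
    then show ?thesis using assms by simp
  qed
  then show "0 < 1 - x * q ^ j" by simp
qed

section \<open>Convergence, splitting and positivity of the infinite product\<close>

lemma qpoch_inf_convergent:
  assumes "0 < q" "q < (1::real)"
  shows "convergent_prod (\<lambda>j. 1 - x * q ^ j)"
  by (intro abs_convergent_prod_imp_convergent_prod summable_imp_abs_convergent_prod)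
     (use assms in \<open>simp add: abs_mult power_abs summable_mult\<close>)

lemma qpoch_tendsto:
  assumes "0 < q" "q < 1"
  shows "qpoch x q \<longlonglongrightarrow> qpoch_inf x q"
proof -
  \<comment> \<open>The partial products of \<open>convergent_prod_LIMSEQ\<close> run over
    \<open>j \<le> n\<close>, one factor more than \<open>qpoch x q n\<close>.\<close>
  have "(\<lambda>n. qpoch x q (Suc n)) \<longlonglongrightarrow> qpoch_inf x q"
    using convergent_prod_LIMSEQ[OF qpoch_inf_convergent[OF assms, of x]]
    by (simp add: qpoch_def qpoch_inf_def lessThan_Suc_atMost)
  then show ?thesis by (rule LIMSEQ_imp_Suc)
qed

lemma qpoch_inf_split:
  assumes "0 < q" "q < 1"
  shows "qpoch_inf x q = qpoch x q n * qpoch_inf (x * q ^ n) q"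
proof (rule LIMSEQ_unique)
  show "(\<lambda>k. qpoch x q (n + k)) \<longlonglongrightarrow> qpoch_inf x q"
    using LIMSEQ_ignore_initial_segment[OF qpoch_tendsto[OF assms, of x], of n]
    by (simp add: add.commute)
  show "(\<lambda>k. qpoch x q (n + k)) \<longlonglongrightarrow> qpoch x q n * qpoch_inf (x * q ^ n) q"
    unfolding qpoch_add by (intro tendsto_mult tendsto_const qpoch_tendsto assms)
qed

text \<open>A limit of positive partial products is only nonnegative; strictness comes from the fact
  that a convergent product without zero factors is nonzero.\<close>

lemma qpoch_inf_pos:
  assumes "0 < q" "q < 1" "x < 1"
  shows "0 < qpoch_inf x q"
proof -
  have "1 - x * q ^ j \<noteq> 0" for j
    using qpoch_pos[OF assms, of "Suc j"] by (auto simp: qpoch_Suc)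
  then have "qpoch_inf x q \<noteq> 0"
    unfolding qpoch_inf_def using qpoch_inf_convergent[OF assms(1,2), of x]
    by (intro prodinf_nonzero) auto
  moreover have "0 \<le> qpoch_inf x q"
    by (rule LIMSEQ_le_const[OF qpoch_tendsto]) (use assms qpoch_pos less_imp_le in blast)+
  ultimately show ?thesis by simp
qed

text \<open>A homogeneous form of \<open>qpoch a q n / qpoch q q n\<close>, so that one theorem
  covers several series: \<open>u = 1\<close>, \<open>v = a\<close> is the q-binomial series, while
  \<open>u = 0\<close>, \<open>v = -1\<close> is Euler's expansion of the infinite product.\<close>

definition qbinom_coeff :: "real \<Rightarrow> real \<Rightarrow> real \<Rightarrow> nat \<Rightarrow> real" where
  "qbinom_coeff u v q n = (\<Prod>j<n. (u - v * q ^ j) / (1 - q ^ Suc j))"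

lemma qbinom_coeff_Suc:
  assumes "0 < q" "q < 1"
  shows "qbinom_coeff u v q (Suc n) * (1 - q ^ Suc n) = qbinom_coeff u v q n * (u - v * q ^ n)"
proof -
  have "q ^ Suc n < 1" using assms by (intro power_Suc_less_one) auto
  then show ?thesis by (simp add: qbinom_coeff_def)
qed

text \<open>The ratio of consecutive terms tends to \<open>u * z\<close> because
  \<open>q ^ n\<close> tends to 0. For \<open>u = 0\<close> this gives convergence for every
  \<open>z\<close>.\<close>

lemma qbinom_coeff_summable:
  assumes q: "0 < q" "q < 1" and "\<bar>u * z\<bar> < 1"
  shows "summable (\<lambda>n. qbinom_coeff u v q n * z ^ n)"
proof -
  obtain r where r: "\<bar>u * z\<bar> < r" "r < 1" using dense[OF assms(3)] by blast
  have lim: "(\<lambda>n. \<bar>(u - v * q ^ n) * z / (1 - q ^ Suc n)\<bar>) \<longlonglongrightarrow> \<bar>(u - v * 0) * z / (1 - 0)\<bar>"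
    by (intro tendsto_intros LIMSEQ_power_zero LIMSEQ_Suc) (use q in auto)
  then have "eventually (\<lambda>n. \<bar>(u - v * q ^ n) * z / (1 - q ^ Suc n)\<bar> < r) sequentially"
    using r by (intro order_tendstoD(2)) auto
  then obtain N where N: "\<And>n. n \<ge> N \<Longrightarrow> \<bar>(u - v * q ^ n) * z / (1 - q ^ Suc n)\<bar> < r"
    unfolding eventually_sequentially by blast
  show ?thesis
  proof (rule summable_ratio_test[OF r(2)])
    fix n assume "N \<le> n"
    have "qbinom_coeff u v q (Suc n) * z ^ Suc n
        = ((u - v * q ^ n) * z / (1 - q ^ Suc n)) * (qbinom_coeff u v q n * z ^ n)"
      by (simp add: qbinom_coeff_def)
    then have "norm (qbinom_coeff u v q (Suc n) * z ^ Suc n)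
        = \<bar>(u - v * q ^ n) * z / (1 - q ^ Suc n)\<bar> * norm (qbinom_coeff u v q n * z ^ n)"
      by (simp only: real_norm_def abs_mult)
    also have "\<dots> \<le> r * norm (qbinom_coeff u v q n * z ^ n)"
      using N[OF \<open>N \<le> n\<close>] by (intro mult_right_mono) auto
    finally show "norm (qbinom_coeff u v q (Suc n) * z ^ Suc n)
        \<le> r * norm (qbinom_coeff u v q n * z ^ n)" .
  qed
qed

text \<open>The sum \<open>f\<close> satisfies
  \<open>(1 - u * z) * f z = (1 - v * z) * f (z * q)\<close>. Iterating \<open>N\<close> times
  produces the partial products on both sides, and \<open>f (z * q ^ N)\<close> tends to
  \<open>f 0 = 1\<close>.\<close>

theorem qbinomial:
  assumes q: "0 < q" "q < 1" and uz: "\<bar>u * z\<bar> < 1"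
  shows "(\<Sum>n. qbinom_coeff u v q n * z ^ n) * qpoch_inf (u * z) q = qpoch_inf (v * z) q"
proof -
  define c where "c = qbinom_coeff u v q"
  define f where "f = (\<lambda>z. \<Sum>n. c n * z ^ n)"
  have less: "\<bar>u * (z * q ^ N)\<bar> < 1" for N
  proof -
    have "\<bar>u * (z * q ^ N)\<bar> = \<bar>u * z\<bar> * q ^ N" using q by (simp add: abs_mult)
    also have "\<dots> \<le> \<bar>u * z\<bar> * 1" using q by (intro mult_left_mono power_le_one) auto
    finally show ?thesis using uz by simp
  qed
  have summ: "summable (\<lambda>n. c n * (z * q ^ N) ^ n)" for N
    unfolding c_def by (rule qbinom_coeff_summable[OF q less])
  have step: "(1 - u * y) * f y = (1 - v * y) * f (y * q)"
    if s: "summable (\<lambda>n. c n * y ^ n)" and s': "summable (\<lambda>n. c n * (y * q) ^ n)" for y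
  proof -
    \<comment> \<open>The difference has coefficients \<open>c n * (1 - q ^ n)\<close>, which the
      recurrence of \<open>qbinom_coeff\<close> expresses through \<open>c (n - 1)\<close>; the term
      at \<open>n = 0\<close> vanishes.\<close>
    have "f y - f (y * q) = (\<Sum>n. c n * y ^ n - c n * (y * q) ^ n)"
      unfolding f_def by (rule suminf_diff[OF s s'])
    also have "\<dots> = (\<Sum>n. c (Suc n) * y ^ Suc n - c (Suc n) * (y * q) ^ Suc n)"
      using suminf_split_head[OF summable_diff[OF s s']] by simp
    also have "(\<lambda>n. c (Suc n) * y ^ Suc n - c (Suc n) * (y * q) ^ Suc n)
        = (\<lambda>n. (u * y) * (c n * y ^ n) - (v * y) * (c n * (y * q) ^ n))"
    proof
      fix n
      have "c (Suc n) * y ^ Suc n - c (Suc n) * (y * q) ^ Suc n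
          = (c (Suc n) * (1 - q ^ Suc n)) * y ^ Suc n"
        by (simp add: algebra_simps power_mult_distrib)
      also have "\<dots> = (u * y) * (c n * y ^ n) - (v * y) * (c n * (y * q) ^ n)"
        unfolding c_def qbinom_coeff_Suc[OF q] by (simp add: algebra_simps power_mult_distrib)
      finally show "c (Suc n) * y ^ Suc n - c (Suc n) * (y * q) ^ Suc n
          = (u * y) * (c n * y ^ n) - (v * y) * (c n * (y * q) ^ n)" .
    qed
    also have "(\<Sum>n. (u * y) * (c n * y ^ n) - (v * y) * (c n * (y * q) ^ n))
        = (u * y) * f y - (v * y) * f (y * q)"
      unfolding f_def using s s'
      by (subst suminf_diff[symmetric]) (auto intro!: summable_mult simp: suminf_mult)
    finally show ?thesis by (simp add: algebra_simps)
  qed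
  have iter: "qpoch (u * z) q N * f z = qpoch (v * z) q N * f (z * q ^ N)" for N
  proof (induction N)
    case (Suc N)
    have "qpoch (u * z) q (Suc N) * f z = (1 - u * (z * q ^ N)) * (qpoch (u * z) q N * f z)"
      by (simp add: qpoch_Suc mult_ac)
    also have "\<dots> = qpoch (v * z) q N * ((1 - u * (z * q ^ N)) * f (z * q ^ N))"
      unfolding Suc.IH by (simp add: mult_ac)
    also have "\<dots> = qpoch (v * z) q N * ((1 - v * (z * q ^ N)) * f (z * q ^ N * q))"
      using step[OF summ[of N]] summ[of "Suc N"] by (simp add: mult_ac)
    finally show ?case by (simp add: qpoch_Suc mult_ac)
  qed simp
  have "(\<lambda>N. f (z * q ^ N)) \<longlonglongrightarrow> f 0"
  \<comment> \<open>Continuity at 0 is read off from convergence at the point \<open>K = z\<close>,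
    which must be nonzero.\<close>
  proof (cases "z = 0")
    case False
    have "isCont f 0" unfolding f_def
      by (rule isCont_powser[where K = z]) (use summ[of 0] False in auto)
    moreover have "(\<lambda>N. z * q ^ N) \<longlonglongrightarrow> z * 0"
      by (intro tendsto_intros LIMSEQ_power_zero) (use q in auto)
    ultimately show ?thesis by (auto dest: isCont_tendsto_compose)
  qed simp
  moreover have "f 0 = 1"
    unfolding f_def using powser_zero[of c] by (simp add: c_def qbinom_coeff_def)
  ultimately have "(\<lambda>N. qpoch (v * z) q N * f (z * q ^ N)) \<longlonglongrightarrow> qpoch_inf (v * z) q * 1"
    by (intro tendsto_mult qpoch_tendsto q) simp
  moreover have "(\<lambda>N. qpoch (u * z) q N * f z) \<longlonglongrightarrow> qpoch_inf (u * z) q * f z"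
    by (intro tendsto_mult qpoch_tendsto q tendsto_const)
  ultimately have "qpoch_inf (u * z) q * f z = qpoch_inf (v * z) q"
    unfolding iter using LIMSEQ_unique by fastforce
  then show ?thesis by (simp add: f_def c_def mult.commute)
qed

section \<open>Specializations of the q-binomial theorem, and continuity of the infinite
  product\<close>

lemma qpoch_inf_0 [simp]: "qpoch_inf 0 q = 1"
  by (simp add: qpoch_inf_def)

lemma qbinom_coeff_1: "qbinom_coeff 1 a q n = qpoch a q n / qpoch q q n"
  by (simp add: qbinom_coeff_def qpoch_def prod_dividef)

text \<open>The exponent is kept real, so that it can later be added to the real exponents of the
  moments.\<close>

lemma qbinom_coeff_euler:
  assumes "0 < q"
  shows "qbinom_coeff 0 (-1) q n = q powr (n * (real n - 1) / 2) / qpoch q q n"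
proof (induction n)
  case (Suc n)
  have "q powr (Suc n * (real (Suc n) - 1) / 2) = q powr (n * (real n - 1) / 2) * q ^ n"
    using assms by (simp add: powr_realpow[symmetric] powr_add[symmetric] field_simps)
  then show ?case using Suc by (simp add: qbinom_coeff_def qpoch_Suc)
qed (use assms in \<open>simp add: qbinom_coeff_def\<close>)

lemma qpoch_inf_eq_suminf:
  assumes q: "0 < q" "q < 1"
  shows "qpoch_inf (- z) q = (\<Sum>n. qbinom_coeff 0 (-1) q n * z ^ n)"
  using qbinomial[OF q, of 0 z "-1"] by simp

lemma qpoch_inf_sums:
  assumes q: "0 < q" "q < 1"
  shows "(\<lambda>n. q powr (n * (real n - 1) / 2) / qpoch q q n * z ^ n) sums qpoch_inf (- z) q"
  using qpoch_inf_eq_suminf[OF q, of z] qbinom_coeff_summable[OF q, of 0 z "-1"]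
  by (simp add: qbinom_coeff_euler q sums_iff)

lemma qbinomial_sums:
  assumes q: "0 < q" "q < 1" and z: "\<bar>z\<bar> < 1"
  shows "(\<lambda>n. qpoch a q n / qpoch q q n * z ^ n) sums (qpoch_inf (a * z) q / qpoch_inf z q)"
proof -
  have "(\<Sum>n. qpoch a q n / qpoch q q n * z ^ n) * qpoch_inf z q = qpoch_inf (a * z) q"
    using qbinomial[OF q, of 1 z a] z by (simp add: qbinom_coeff_1)
  moreover have "0 < qpoch_inf z q"
    using z by (intro qpoch_inf_pos q) auto
  moreover have "summable (\<lambda>n. qpoch a q n / qpoch q q n * z ^ n)"
    using qbinom_coeff_summable[OF q, of 1 z a] z by (simp add: qbinom_coeff_1)
  ultimately show ?thesis
    unfolding sums_iff by (intro conjI eq_divide_imp) auto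
qed

text \<open>By Euler's expansion the infinite product is an everywhere convergent power
  series.\<close>

lemma isCont_qpoch_inf:
  assumes q: "0 < q" "q < 1"
  shows "isCont (\<lambda>x. qpoch_inf x q) x"
proof -
  have "isCont (\<lambda>z. \<Sum>n. qbinom_coeff 0 (-1) q n * z ^ n) (- x)"
    by (rule isCont_powser[where K = "\<bar>x\<bar> + 1"]) (use qbinom_coeff_summable[OF q] in auto)
  then have "isCont (\<lambda>z. qpoch_inf (- z) q) (- x)"
    by (simp add: qpoch_inf_eq_suminf[OF q])
  then have "isCont ((\<lambda>z. qpoch_inf (- z) q) \<circ> uminus) x"
    by (intro continuous_at_compose) auto
  then show ?thesis by (simp add: o_def)
qed

lemma borel_measurable_qpoch_inf [measurable (raw)]:
  assumes q: "0 < q" "q < 1" and f: "f \<in> borel_measurable M"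
  shows "(\<lambda>x. qpoch_inf (f x) q) \<in> borel_measurable M"
proof -
  have "(\<lambda>x. qpoch_inf x q) \<in> borel_measurable borel"
    by (intro borel_measurable_continuous_onI continuous_at_imp_continuous_on ballI isCont_qpoch_inf q)
  from measurable_compose[OF f this] show ?thesis .
qed

section \<open>The finite double sum\<close>

lemma qpoch_q_pos:
  assumes "0 < q" "q < 1"
  shows "0 < qpoch q q n"
  using assms by (intro qpoch_pos)

text \<open>The \<open>q\<close>-Chu--Vandermonde sum multiplied by \<open>(c; q)\<^sub>m\<close> with \<open>c = b e\<close>, so that no parameter
  has to keep a denominator away from \<open>0\<close>.\<close>

lemma q_vandermonde_aux:
  assumes q: "0 < q" "q < (1::real)"
  shows "(\<Sum>k\<le>m. (-1) ^ k * q ^ (k * (k - 1) div 2) * qpoch b q k * e ^ k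
            * qpoch (b * e * q ^ k) q (m - k) / (qpoch q q k * qpoch q q (m - k)))
         = qpoch e q m / qpoch q q m"
proof (induction m arbitrary: b)
  case (Suc m)
  define T where "T b m k = (-1) ^ k * q ^ (k * (k - 1) div 2) * qpoch b q k * e ^ k
            * qpoch (b * e * q ^ k) q (m - k) / (qpoch q q k * qpoch q q (m - k))" for b m k
  have T: "(\<Sum>k\<le>m. T b m k) = qpoch e q m / qpoch q q m" for b
    using Suc.IH[of b] by (simp add: T_def)
  have nz: "qpoch q q k \<noteq> 0" for k
    using qpoch_q_pos[OF q, of k] by simp
  have nz1: "1 - q ^ Suc k \<noteq> 0" for k
    using power_Suc_less_one[of q k] q by simp
  \<comment> \<open>Two term relations lower \<open>m\<close>: \<open>A\<close> keeps
    \<open>k\<close> and \<open>b\<close>, while \<open>B\<close> lowers \<open>k\<close> as well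
    and moves \<open>b\<close> to \<open>b * q\<close>. The shift in \<open>B\<close> is why the
    induction is for arbitrary \<open>b\<close>.\<close>
  have A: "(1 - q ^ (Suc m - k)) * T b (Suc m) k = (1 - b * e * q ^ m) * T b m k" if "k \<le> m" for k
  proof -
    have *: "Suc m - k = Suc (m - k)" using that by simp
    have pw: "b * e * q ^ k * q ^ (m - k) = b * e * q ^ m"
      using that by (simp add: power_add[symmetric])
    have eq: "T b (Suc m) k = (-1) ^ k * q ^ (k * (k - 1) div 2) * qpoch b q k * e ^ k
            * (qpoch (b * e * q ^ k) q (m - k) * (1 - b * e * q ^ m))
            / (qpoch q q k * (qpoch q q (m - k) * (1 - q ^ Suc (m - k))))"
      unfolding T_def * qpoch_Suc pw by simp
    \<comment> \<open>The cancellation is stated for abstract reals so that the simplifier does not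
      expand the q-factorials.\<close>
    have "x * (N * (P * y) / (u * (v * x))) = y * (N * P / (u * v))" if "x \<noteq> 0"
      for x y u v N P :: real
      using that by simp
    from this[OF nz1] show ?thesis unfolding eq unfolding * T_def .
  qed
  have B: "q ^ (m - k) * (1 - q ^ Suc k) * T b (Suc m) (Suc k)
      = - e * q ^ m * (1 - b) * T (b * q) m k" if "k \<le> m" for k
  proof -
    have tri: "Suc k * (Suc k - 1) div 2 = k * (k - 1) div 2 + k"
      by (cases k) (simp_all add: algebra_simps)
    have pw: "q ^ m = q ^ k * q ^ (m - k)"
      using that by (simp add: power_add[symmetric])
    have eq: "T b (Suc m) (Suc k) = - ((-1) ^ k) * (q ^ (k * (k - 1) div 2) * q ^ k)
            * ((1 - b) * qpoch (b * q) q k) * (e * e ^ k)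
            * qpoch (b * q * e * q ^ k) q (m - k)
            / (qpoch q q k * (1 - q ^ Suc k) * qpoch q q (m - k))"
      unfolding T_def tri qpoch_Suc_left[of b] qpoch_Suc[of q q k] power_add diff_Suc_Suc
      by (simp add: mult_ac)
    have "w * x * (- N * (P * y) * ((1 - b) * B) * (e * E) * R / (u * x * v))
        = - e * (y * w) * (1 - b) * (N * P * B * E * R / (u * v))" if "x \<noteq> 0"
      for w x y u v N P B E R :: real
      using that by simp
    from this[OF nz1] show ?thesis unfolding eq pw unfolding T_def .
  qed
  \<comment> \<open>The weight is split as \<open>1 - q ^ Suc m = (1 - q ^ (Suc m - k)) + q ^ (Suc m
    - k) * (1 - q ^ k)\<close>; \<open>A\<close> applies to the first part and \<open>B\<close> to
    the second.\<close>
  have "(1 - q ^ Suc m) * (\<Sum>k\<le>Suc m. T b (Suc m) k)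
      = (\<Sum>k\<le>Suc m. (1 - q ^ (Suc m - k)) * T b (Suc m) k
          + q ^ (Suc m - k) * (1 - q ^ k) * T b (Suc m) k)"
    unfolding sum_distrib_left
  proof (intro sum.cong refl)
    fix k assume "k \<in> {..Suc m}"
    then have "q ^ Suc m = q ^ (Suc m - k) * q ^ k"
      by (simp only: power_add[symmetric]) simp
    then show "(1 - q ^ Suc m) * T b (Suc m) k = (1 - q ^ (Suc m - k)) * T b (Suc m) k
          + q ^ (Suc m - k) * (1 - q ^ k) * T b (Suc m) k"
      by (simp only:) (simp add: algebra_simps)
  qed
  \<comment> \<open>The first sum loses its term \<open>k = Suc m\<close> and the second its term
    \<open>k = 0\<close>, since their factors vanish.\<close>
  also have "\<dots> = (\<Sum>k\<le>m. (1 - q ^ (Suc m - k)) * T b (Suc m) k)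
      + (\<Sum>k\<le>m. q ^ (m - k) * (1 - q ^ Suc k) * T b (Suc m) (Suc k))"
    unfolding sum.distrib by (subst (2) sum.atMost_Suc_shift) simp
  also have "\<dots> = (\<Sum>k\<le>m. (1 - b * e * q ^ m) * T b m k)
      + (\<Sum>k\<le>m. - e * q ^ m * (1 - b) * T (b * q) m k)"
    by (intro arg_cong2[where f = "(+)"] sum.cong refl A B) auto
  \<comment> \<open>The parameter \<open>b\<close> drops out:
    \<open>(1 - b * e * q ^ m) - e * q ^ m * (1 - b) = 1 - e * q ^ m\<close>.\<close>
  also have "\<dots> = (1 - e * q ^ m) * (qpoch e q m / qpoch q q m)"
    unfolding sum_distrib_left[symmetric] T distrib_right[symmetric] by (simp add: algebra_simps)
  also have "\<dots> = (1 - q ^ Suc m) * (qpoch e q (Suc m) / qpoch q q (Suc m))"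
    using nz1[of m] by (simp add: qpoch_Suc)
  finally have "(\<Sum>k\<le>Suc m. T b (Suc m) k) = qpoch e q (Suc m) / qpoch q q (Suc m)"
    by (rule mult_left_cancel[OF nz1, THEN iffD1])
  then show ?case unfolding T_def .
qed simp

text \<open>Each factor obeys \<open>(1 - q powr (- m) * q ^ j) * q ^ m = - (q ^ j) * (1 - q ^ (m -
  j))\<close>; the signs, the powers of \<open>q\<close> and the upper end of
  \<open>(q; q)_m\<close> are collected one factor at a time.\<close>

lemma qpoch_neg_power:
  assumes q: "0 < q" "k \<le> m"
  shows "qpoch (q powr (- real m)) q k * q ^ (m * k) * qpoch q q (m - k)
     = (-1) ^ k * q ^ (k * (k - 1) div 2) * qpoch q q m"
  using assms(2)
proof (induction k)
  case (Suc k)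
  have tri: "Suc k * (Suc k - 1) div 2 = k * (k - 1) div 2 + k"
    by (cases k) (simp_all add: algebra_simps)
  have mk: "m - k = Suc (m - Suc k)" using Suc.prems by simp
  have p: "q powr (- real m) * q ^ m = 1"
    using q by (simp add: powr_realpow[symmetric] powr_add[symmetric])
  have "q ^ m = q ^ k * q ^ (m - k)"
    using Suc.prems by (simp add: power_add[symmetric])
  then have h: "(1 - q powr (- real m) * q ^ k) * q ^ m = - (q ^ k * (1 - q ^ (m - k)))"
    using p by (simp add: algebra_simps)
  have "qpoch (q powr (- real m)) q (Suc k) * q ^ (m * Suc k) * qpoch q q (m - Suc k)
     = (1 - q powr (- real m) * q ^ k) * q ^ m
         * (qpoch (q powr (- real m)) q k * q ^ (m * k) * qpoch q q (m - Suc k))"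
    by (simp add: qpoch_Suc power_add mult_ac)
  also have "\<dots>
     = - (q ^ k) * (qpoch (q powr (- real m)) q k * q ^ (m * k) * (qpoch q q (m - Suc k) * (1 - q ^ (m - k))))"
    unfolding h by (simp add: mult_ac)
  also have "qpoch q q (m - Suc k) * (1 - q ^ (m - k)) = qpoch q q (m - k)"
    unfolding mk by (simp add: qpoch_Suc)
  also have "qpoch (q powr - real m) q k * q ^ (m * k) * qpoch q q (m - k)
     = (-1) ^ k * q ^ (k * (k - 1) div 2) * qpoch q q m"
    using Suc by simp
  finally show ?case unfolding tri by (simp add: power_add)
qed (use q in simp)

text \<open>This is the usual terminating 2phi1 sum at argument \<open>c * q ^ m / b\<close>, with
  \<open>e\<close> in the role of \<open>c / b\<close>. It follows from the auxiliary sum by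
  reversing \<open>(q^(-m); q)_k\<close> and writing
  \<open>(c; q)_m = (c; q)_k (c q^k; q)_(m-k)\<close>; \<open>c < 1\<close> keeps the denominators
  nonzero.\<close>

lemma q_vandermonde:
  assumes q: "0 < q" "q < 1" and c: "c < 1" and that: "c = b * e"
  shows "(\<Sum>k\<le>m. qpoch (q powr (- real m)) q k * qpoch b q k / (qpoch q q k * qpoch c q k)
            * (e * q ^ m) ^ k) = qpoch e q m / qpoch c q m"
proof -
  have nz: "qpoch q q k \<noteq> 0" "qpoch c q k \<noteq> 0" for k
    using qpoch_q_pos[OF q, of k] qpoch_pos[OF q c, of k] by auto
  have "(\<Sum>k\<le>m. qpoch (q powr (- real m)) q k * qpoch b q k / (qpoch q q k * qpoch c q k)
            * (e * q ^ m) ^ k)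
      = (\<Sum>k\<le>m. qpoch q q m / qpoch c q m * ((-1) ^ k * q ^ (k * (k - 1) div 2) * qpoch b q k * e ^ k
            * qpoch (b * e * q ^ k) q (m - k) / (qpoch q q k * qpoch q q (m - k))))"
  proof (intro sum.cong refl)
    fix k assume "k \<in> {..m}"
    then have k: "k \<le> m" by simp
    have c: "qpoch c q m = qpoch c q k * qpoch (b * e * q ^ k) q (m - k)"
      using qpoch_add[of c q k "m - k"] k that by simp
    have "qpoch (q powr (- real m)) q k * q ^ (m * k)
      = (-1) ^ k * q ^ (k * (k - 1) div 2) * qpoch q q m / qpoch q q (m - k)"
      using qpoch_neg_power[OF q(1) k] nz(1)[of "m - k"] by (simp add: field_simps)
    then have "qpoch (q powr (- real m)) q k * qpoch b q k / (qpoch q q k * qpoch c q k)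
            * (e * q ^ m) ^ k = ((-1) ^ k * q ^ (k * (k - 1) div 2) * qpoch q q m / qpoch q q (m - k))
              * qpoch b q k / (qpoch q q k * qpoch c q k) * e ^ k"
      by (simp add: power_mult_distrib power_mult[symmetric] mult_ac)
    then show "qpoch (q powr (- real m)) q k * qpoch b q k / (qpoch q q k * qpoch c q k)
            * (e * q ^ m) ^ k = qpoch q q m / qpoch c q m * ((-1) ^ k * q ^ (k * (k - 1) div 2) * qpoch b q k * e ^ k
            * qpoch (b * e * q ^ k) q (m - k) / (qpoch q q k * qpoch q q (m - k)))"
      using nz(2)[of m] unfolding c by (simp add: mult_ac)
  qed
  also have "\<dots> = qpoch e q m / qpoch c q m"
    unfolding sum_distrib_left[symmetric] q_vandermonde_aux[OF q] using nz(1) by simp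
  finally show ?thesis .
qed

section \<open>Orthogonality as an identity of finite sums\<close>

text \<open>For fixed \<open>j\<close> the sum over \<open>k\<close> is a q-Chu-Vandermonde sum
  whose value contains \<open>(q^(j+1-m); q)_m\<close>. This vanishes for \<open>j < m\<close>, so
  with \<open>n \<le> m\<close> only \<open>j = n = m\<close> can survive. In the application
  \<open>s = \<alpha> + \<beta> + 2\<close>.\<close>

lemma orthogonality_sum_le:
  fixes q s :: real
  assumes q: "0 < q" "q < 1" and s: "0 < s" and nm: "n \<le> m"
  shows "(\<Sum>j\<le>n. \<Sum>k\<le>m. qpoch (q powr (- real n)) q j * qpoch (q powr (real n + s - 1)) q j
            * qpoch (q powr (- real m)) q k * qpoch (q powr (real m + s - 1)) q k
            / (qpoch q q j * qpoch q q k * qpoch (q powr s) q (j + k)) * q ^ (j * k + j + k))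
    = (if n = m then (-1) ^ n * (if n = 0 then 1
                 else (1 - q powr (real n + s - 1)) / (1 - q powr (2 * real n + s - 1)))
              * qpoch q q n / (q ^ (n * (n - 1) div 2) * qpoch (q powr s) q n) else 0)"
proof -
  have s1: "q powr s < 1" using powr_less_mono2[OF s, of q 1] q by simp
  have sj: "q powr s * q ^ j < 1" for j
  proof -
    have "q powr s * q ^ j \<le> q powr s * 1"
      using q by (intro mult_left_mono power_le_one) auto
    then show ?thesis using s1 by simp
  qed
  have nz: "qpoch q q k \<noteq> 0" "qpoch (q powr s) q k \<noteq> 0" for k
    using qpoch_q_pos[OF q, of k] qpoch_pos[OF q s1, of k] by auto
  define A where "A j = qpoch (q powr (- real n)) q j * qpoch (q powr (real n + s - 1)) q j" for j
  \<comment> \<open>The quotient of the lower parameter \<open>q powr s * q ^ j\<close> by the upper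
    parameter \<open>q powr (real m + s - 1)\<close>. Then \<open>e j * q ^ m = q ^ Suc j\<close> is
    exactly the argument of the inner sum.\<close>
  define e where "e j = q powr (real j + 1 - real m)" for j
  have inner: "(\<Sum>k\<le>m. A j * qpoch (q powr (- real m)) q k * qpoch (q powr (real m + s - 1)) q k
            / (qpoch q q j * qpoch q q k * qpoch (q powr s) q (j + k)) * q ^ (j * k + j + k))
      = A j * q ^ j / qpoch q q j * (qpoch (e j) q m / qpoch (q powr s) q (j + m))" for j
  proof -
    have e: "q powr s * q ^ j = q powr (real m + s - 1) * e j"
      unfolding e_def using q by (simp add: powr_realpow[symmetric] powr_add[symmetric])
    have e': "e j * q ^ m = q ^ Suc j"
      unfolding e_def using q by (simp add: powr_realpow[symmetric] powr_add[symmetric] add.commute del: power_Suc)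
    have "(\<Sum>k\<le>m. A j * qpoch (q powr (- real m)) q k * qpoch (q powr (real m + s - 1)) q k
            / (qpoch q q j * qpoch q q k * qpoch (q powr s) q (j + k)) * q ^ (j * k + j + k))
      = (\<Sum>k\<le>m. A j * q ^ j / (qpoch q q j * qpoch (q powr s) q j) * (qpoch (q powr (- real m)) q k
           * qpoch (q powr (real m + s - 1)) q k
            / (qpoch q q k * qpoch (q powr s * q ^ j) q k) * (e j * q ^ m) ^ k))"
      unfolding e' qpoch_add
      by (intro sum.cong refl)
         (simp add: power_add[symmetric] power_mult[symmetric] mult_ac add_ac del: power_Suc)
    also have "\<dots> = A j * q ^ j / (qpoch q q j * qpoch (q powr s) q j)
          * (qpoch (e j) q m / qpoch (q powr s * q ^ j) q m)"
      unfolding sum_distrib_left[symmetric] by (subst q_vandermonde[OF q sj e]) simp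
    finally show ?thesis unfolding qpoch_add by simp
  qed
  have e0: "qpoch (e j) q m = 0" if "j < m" for j
  proof (rule qpoch_eq_0)
    show "m - Suc j < m" using that by simp
    show "e j * q ^ (m - Suc j) = 1" unfolding e_def using that q
      by (simp add: powr_realpow[symmetric] powr_add[symmetric] of_nat_diff)
  qed
  have "(\<Sum>j\<le>n. \<Sum>k\<le>m. A j * qpoch (q powr (- real m)) q k * qpoch (q powr (real m + s - 1)) q k
            / (qpoch q q j * qpoch q q k * qpoch (q powr s) q (j + k)) * q ^ (j * k + j + k))
      = (\<Sum>j\<le>n. if j = m then A m * q ^ m / qpoch q q m * (qpoch (e m) q m / qpoch (q powr s) q (m + m)) else 0)"
    unfolding inner using nm e0 by (intro sum.cong refl) auto
  also have "\<dots> = (if n = m then A m * q ^ m / qpoch q q m * (qpoch (e m) q m / qpoch (q powr s) q (m + m)) else 0)"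
    using nm by auto
  also have "\<dots> = (if n = m then (-1) ^ n * (if n = 0 then 1
                 else (1 - q powr (real n + s - 1)) / (1 - q powr (2 * real n + s - 1)))
              * qpoch q q n / (q ^ (n * (n - 1) div 2) * qpoch (q powr s) q n) else 0)"
  proof (cases "n = m")
    case True
    \<comment> \<open>Hence \<open>qpoch (e m) q m\<close> cancels the denominator
      \<open>qpoch q q m\<close>.\<close>
    have "e m = q" using q by (simp add: e_def)
    \<comment> \<open>One of the two triangular exponents cancels against the numerator of
      \<open>qpoch_neg_power\<close>; the other stays in the denominator of the norm.\<close>
    have sq: "n * n = n + n * (n - 1) div 2 + n * (n - 1) div 2"
    proof -
      have "n * n = n + n * (n - 1)" by (cases n) auto
      moreover have "n * (n - 1) = n * (n - 1) div 2 + n * (n - 1) div 2"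
        using dvd_mult_div_cancel[of 2 "n * (n - 1)"] by (cases n) (auto simp: mult_2)
      ultimately show ?thesis by linarith
    qed
    have "qpoch (q powr (- real n)) q n * q ^ (n * n) = (-1) ^ n * q ^ (n * (n - 1) div 2) * qpoch q q n"
      using qpoch_neg_power[OF q(1), of n n] by simp
    then have neg: "qpoch (q powr (- real n)) q n * q ^ n = (-1) ^ n * qpoch q q n / q ^ (n * (n - 1) div 2)"
      using q unfolding sq power_add by (simp add: field_simps)
    have "qpoch (q powr (real n + s - 1)) q n / qpoch (q powr s) q (n + n)
        = (if n = 0 then 1 else (1 - q powr (real n + s - 1)) / (1 - q powr (2 * real n + s - 1)))
          / qpoch (q powr s) q n"
    \<comment> \<open>At \<open>n = 0\<close> the displayed quotient could be 0/0, namely for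
      \<open>s = 1\<close>, so its value 1 is treated apart. For \<open>n = Suc l\<close> both
      q-factorials share the \<open>l\<close> factors of \<open>(q^(s+n); q)_l\<close>.\<close>
    proof (cases n)
      case (Suc l)
      have 1: "q powr (real n + s - 1) * q = q powr s * q ^ n"
        using q Suc by (simp add: powr_realpow[symmetric] powr_add[symmetric] powr_mult_base[symmetric] mult.commute add.commute del: power_Suc)
      have 2: "q powr s * q ^ n * q ^ l = q powr (2 * real n + s - 1)"
        using q Suc by (simp add: powr_realpow[symmetric] powr_add[symmetric] algebra_simps del: power_Suc)
      have "qpoch (q powr (real n + s - 1)) q n = (1 - q powr (real n + s - 1)) * qpoch (q powr s * q ^ n) q l"
        using qpoch_Suc_left[of "q powr (real n + s - 1)" q l] unfolding 1 Suc[symmetric] .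
      moreover have "qpoch (q powr s) q (n + n) = qpoch (q powr s) q n
          * (qpoch (q powr s * q ^ n) q l * (1 - q powr (2 * real n + s - 1)))"
        using qpoch_Suc[of "q powr s * q ^ n" q l] unfolding 2 Suc[symmetric] qpoch_add by simp
      moreover have "qpoch (q powr s * q ^ n) q l \<noteq> 0"
        using qpoch_pos[OF q sj] by (metis less_irrefl)
      ultimately show ?thesis using Suc by simp
    qed simp
    moreover have "A n * q ^ n / qpoch (q powr s) q (n + n)
      = (qpoch (q powr (- real n)) q n * q ^ n)
        * (qpoch (q powr (real n + s - 1)) q n / qpoch (q powr s) q (n + n))"
      by (simp add: A_def mult_ac)
    ultimately have "A n * q ^ n / qpoch (q powr s) q (n + n) = ((-1) ^ n * qpoch q q n / q ^ (n * (n - 1) div 2))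
      * ((if n = 0 then 1 else (1 - q powr (real n + s - 1)) / (1 - q powr (2 * real n + s - 1)))
          / qpoch (q powr s) q n)"
      unfolding neg by simp
    then show ?thesis using True \<open>e m = q\<close> nz(1)[of m] by (simp add: mult_ac)
  qed simp
  finally show ?thesis unfolding A_def .
qed

text \<open>The summand is symmetric under exchange of \<open>(n, j)\<close> and
  \<open>(m, k)\<close>, so \<open>n > m\<close> follows by swapping the sums.\<close>

lemma orthogonality_sum:
  fixes q s :: real
  assumes q: "0 < q" "q < 1" and s: "0 < s"
  shows "(\<Sum>j\<le>n. \<Sum>k\<le>m. qpoch (q powr (- real n)) q j * qpoch (q powr (real n + s - 1)) q j
            * qpoch (q powr (- real m)) q k * qpoch (q powr (real m + s - 1)) q k
            / (qpoch q q j * qpoch q q k * qpoch (q powr s) q (j + k)) * q ^ (j * k + j + k))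
    = (if n = m then (-1) ^ n * (if n = 0 then 1
                 else (1 - q powr (real n + s - 1)) / (1 - q powr (2 * real n + s - 1)))
              * qpoch q q n / (q ^ (n * (n - 1) div 2) * qpoch (q powr s) q n) else 0)"
proof (cases "n \<le> m")
  case True
  then show ?thesis by (rule orthogonality_sum_le[OF q s])
next
  case False
  then show ?thesis
    by (subst sum.swap) (use orthogonality_sum_le[OF q s, of m n] in \<open>simp add: mult_ac add_ac\<close>)
qed

section \<open>The weight and its moments\<close>

text \<open>The open half-line, where every factor of the weight is positive.\<close>

abbreviation lpos :: "real measure" where
  "lpos \<equiv> restrict_space lborel {0<..}"

lemma borel_measurable_lpos: "f \<in> borel_measurable borel \<Longrightarrow> f \<in> borel_measurable lpos"
  by (intro measurable_restrict_space1) simp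

lemma space_lpos [simp]: "space lpos = {0<..}"
  by (simp add: space_restrict_space)

lemma nn_integral_lpos_scale:
  assumes [measurable]: "f \<in> borel_measurable borel" and r: "0 < r"
  shows "(\<integral>\<^sup>+t. f t \<partial>lpos) = ennreal r * (\<integral>\<^sup>+t. f (r * t) \<partial>lpos)"
proof -
  have "(\<integral>\<^sup>+t. f t \<partial>lpos) = (\<integral>\<^sup>+t. f t * indicator {0<..} t \<partial>lborel)"
    by (simp add: nn_integral_restrict_space)
  also have "\<dots> = ennreal \<bar>r\<bar> * (\<integral>\<^sup>+t. f (0 + r * t) * indicator {0<..} (0 + r * t) \<partial>lborel)"
    by (rule nn_integral_real_affine) (use r in auto)
  also have "(\<integral>\<^sup>+t. f (0 + r * t) * indicator {0<..} (0 + r * t) \<partial>lborel)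
      = (\<integral>\<^sup>+t. f (r * t) * indicator {0<..} t \<partial>lborel)"
    using r by (intro nn_integral_cong) (auto simp: indicator_def zero_less_mult_iff)
  finally show ?thesis using r by (simp add: nn_integral_restrict_space)
qed

text \<open>Finiteness of \<open>x\<close> is part of the conclusion: this is how the zeroth moment,
  at first only an extended real, is shown to be finite.\<close>

lemma ennreal_eq_divideI:
  assumes "x * ennreal a = ennreal b" "0 < a" "0 \<le> b"
  shows "x = ennreal (b / a)"
proof -
  have "x = x * (ennreal a * ennreal (1 / a))"
    using assms by (simp add: ennreal_mult[symmetric])
  also have "\<dots> = ennreal b * ennreal (1 / a)"
    by (simp only: mult.assoc[symmetric] assms)
  also have "\<dots> = ennreal (b / a)"
    using ennreal_mult[of b "1 / a"] assms by simp
  finally show ?thesis .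
qed

text \<open>The part of the density that is free of \<open>\<alpha>\<close> and
  \<open>\<beta>\<close>. With \<open>x = t q^(-c)\<close> the denominator is
  \<open>(-x, -q/x; q)_inf\<close>, the product in Jacobi's triple product without
  \<open>(q; q)_inf\<close>.\<close>

definition ram_weight :: "real \<Rightarrow> real \<Rightarrow> real \<Rightarrow> real" where
  "ram_weight c q t = t powr (c - 1)
     / (qpoch_inf (- t * q powr (- c)) q * qpoch_inf (- (1 / t) * q powr (1 + c)) q)"

text \<open>Extended values allow the recurrences to be used before any moment is known to be
  finite.\<close>

definition ram_moment :: "real \<Rightarrow> real \<Rightarrow> real \<Rightarrow> ennreal" where
  "ram_moment c q s = (\<integral>\<^sup>+t. ennreal (t powr s * ram_weight c q t) \<partial>lpos)"

text \<open>The substitution \<open>u / (1 + u)\<close> carries the half-line onto the unit interval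
  and the integrand to that of \<open>Beta c (1 - c)\<close>, where the denominator
  \<open>Gamma 1\<close> is 1.\<close>

lemma nn_integral_beta_prime:
  assumes c: "0 < c" "c < (1::real)"
  shows "(\<integral>\<^sup>+t. ennreal (t powr (c - 1) / (1 + t)) \<partial>lpos) = ennreal (Gamma c * Gamma (1 - c))"
proof -
  define f where "f t = t powr (c - 1) * (1 - t) powr ((1 - c) - 1)" for t :: real
  define g where "g u = u / (1 + u)" for u :: real
  have "(f has_integral Beta c (1 - c)) {0<..<1}"
    using has_integral_Beta_real[of c "1 - c"] c by (simp add: f_def[abs_def] has_integral_Icc_iff_Ioo)
  then have int: "f absolutely_integrable_on {0<..<1}" "integral {0<..<1} f = Gamma c * Gamma (1 - c)"
    by (auto intro!: nonnegative_absolutely_integrable_1 simp: f_def Beta_def integral_unique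
        dest: has_integral_integrable)
  have img: "g ` {0<..} = {0<..<1}"
  proof (intro equalityI subsetI)
    fix x assume "x \<in> {0<..<(1::real)}"
    then have "x = g (x / (1 - x))" "x / (1 - x) \<in> {0<..}"
      by (auto simp: g_def field_simps)
    then show "x \<in> g ` {0<..}" by blast
  qed (auto simp: g_def)
  have der: "(g has_field_derivative 1 / (1 + u)\<^sup>2) (at u within {0<..})" if "u \<in> {0<..}" for u
    unfolding g_def using that
    by (auto intro!: derivative_eq_intros simp: power2_eq_square field_simps)
  have inj: "inj_on g {0<..}"
    by (auto simp: inj_on_def g_def field_simps)
  have "(\<lambda>u. \<bar>1 / (1 + u)\<^sup>2\<bar> * f (g u)) absolutely_integrable_on {0<..} \<and>
      integral {0<..} (\<lambda>u. \<bar>1 / (1 + u)\<^sup>2\<bar> * f (g u)) = Gamma c * Gamma (1 - c)"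
    using has_absolute_integral_change_of_variables_1'[OF _ der inj, of f "Gamma c * Gamma (1 - c)"]
      int img by simp
  then have I: "((\<lambda>u. \<bar>1 / (1 + u)\<^sup>2\<bar> * f (g u)) has_integral (Gamma c * Gamma (1 - c))) {0<..}"
    using set_lebesgue_integral_eq_integral(1) by (auto simp: has_integral_iff)
  have eq: "\<bar>1 / (1 + u)\<^sup>2\<bar> * f (g u) = u powr (c - 1) / (1 + u)" if u: "0 < u" for u
  proof -
    have "1 - g u = 1 / (1 + u)" using u by (simp add: g_def field_simps)
    then have "f (g u) = u powr (c - 1) / (1 + u) powr (c - 1) * (1 + u) powr c"
      unfolding f_def using u by (simp add: g_def powr_divide powr_minus_divide)
    also have "\<dots> = u powr (c - 1) * (1 + u)"
      using u by (simp add: powr_diff)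
    finally show ?thesis using u by (simp add: power2_eq_square)
  qed
  have "((\<lambda>u. u powr (c - 1) / (1 + u)) has_integral (Gamma c * Gamma (1 - c))) {0<..}"
    using has_integral_eq[OF _ I, of "\<lambda>u. u powr (c - 1) / (1 + u)"] eq by simp
  from nn_integral_has_integral_lebesgue[OF _ this]
  have "(\<integral>\<^sup>+u. ennreal (indicator {0<..} u * (u powr (c - 1) / (1 + u))) \<partial>lborel)
      = ennreal (Gamma c * Gamma (1 - c))" by simp
  moreover have "(\<integral>\<^sup>+u. ennreal (indicator {0<..} u * (u powr (c - 1) / (1 + u))) \<partial>lborel)
      = (\<integral>\<^sup>+u. ennreal (u powr (c - 1) / (1 + u)) \<partial>lpos)"
    by (simp add: nn_integral_restrict_space) (intro nn_integral_cong, auto simp: indicator_def)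
  ultimately show ?thesis by simp
qed

text \<open>The raw quotient inside \<open>Gamma_quot\<close>. At integers it is 0 by the
  conventions for poles and division, so the continuous extension is reached only through
  limits.\<close>

definition gamma_ratio :: "real \<Rightarrow> real \<Rightarrow> real" where
  "gamma_ratio q x = (Gamma_q q x * Gamma_q q (1 - x)) / (Gamma x * Gamma (1 - x))"

text \<open>The closed form of the zeroth moment, established in
  \<open>ram_moment_0\<close>.\<close>

definition ram_mass :: "real \<Rightarrow> real \<Rightarrow> real" where
  "ram_mass q c = (1 - q) * qpoch_inf q q * q powr c\<^sup>2 / Gamma_quot q c"

text \<open>The coefficient of \<open>t ^ j / qpoch (- t * q powr (\<beta> + 1)) q j\<close> in the
  rational function; the sign of the series cancels the sign of the argument
  \<open>- t * q\<close>.\<close>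

definition p_coeff :: "real \<Rightarrow> nat \<Rightarrow> real \<Rightarrow> real \<Rightarrow> nat \<Rightarrow> real" where
  "p_coeff q n \<alpha> \<beta> j = qpoch (q powr (- real n)) q j * qpoch (q powr (real n + \<alpha> + \<beta> + 1)) q j
     / (qpoch (q powr (\<alpha> + 1)) q j * qpoch q q j) * q ^ (j * (j - 1) div 2) * q ^ j"

context
  fixes q :: real
  assumes q: "0 < q" "q < 1"
begin

lemma qpoch_inf_Suc: "qpoch_inf x q = (1 - x) * qpoch_inf (x * q) q"
  using qpoch_inf_split[OF q, of x 1] by (simp add: qpoch_Suc)

lemma powr_less_one_of_pos: "0 < x \<Longrightarrow> q powr x < 1"
  using powr_less_mono2[of x q 1] q by simp

lemma qpoch_inf_powr_pos: "0 < x \<Longrightarrow> 0 < qpoch_inf (q powr x) q"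
  by (intro qpoch_inf_pos q powr_less_one_of_pos)

lemma qpoch_inf_neg_pos: "0 < t \<Longrightarrow> 0 < qpoch_inf (- t * q powr b) q"
  by (intro qpoch_inf_pos q) (smt (verit) mult_minus_left mult_pos_pos powr_gt_zero q)

lemma qpoch_inf_neg_inverse_pos: "0 < t \<Longrightarrow> 0 < qpoch_inf (- (1 / t) * q powr b) q"
  using qpoch_inf_neg_pos[of "1 / t" b] by simp

lemma ram_weight_pos: "0 < t \<Longrightarrow> 0 < ram_weight c q t"
  unfolding ram_weight_def by (intro divide_pos_pos mult_pos_pos qpoch_inf_neg_pos qpoch_inf_neg_inverse_pos) auto

lemma borel_measurable_ram_weight [measurable]: "ram_weight c q \<in> borel_measurable borel"
proof -
  note [measurable] = borel_measurable_qpoch_inf[OF q]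
  show ?thesis unfolding ram_weight_def by measurable
qed

section \<open>Functional equations of the weight and its integer moments\<close>

text \<open>With \<open>x = t q^(-c)\<close>, passing to \<open>q t\<close> removes the factor
  \<open>1 + x\<close> from the first product and adds \<open>1 + 1/x\<close> to the second, and
  \<open>(1 + x) / (1 + 1/x) = x\<close>.\<close>

lemma ram_weight_scale:
  assumes t: "0 < t"
  shows "q * ram_weight c q (q * t) = t * ram_weight c q t"
proof -
  define A where "A = qpoch_inf (- (q * t) * q powr (- c)) q"
  define B where "B = qpoch_inf (- (1 / t) * q powr (1 + c)) q"
  define x where "x = t * q powr (- c)"
  have A: "qpoch_inf (- t * q powr (- c)) q = (1 + x) * A"
    unfolding A_def x_def by (subst qpoch_inf_Suc) (simp add: mult_ac)
  have "1 / (q * t) * q powr (1 + c) = 1 / x" "1 / x * q = 1 / t * q powr (1 + c)"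
    unfolding x_def using q by (simp_all add: powr_add powr_minus field_simps)
  then have B: "qpoch_inf (- (1 / (q * t)) * q powr (1 + c)) q = (1 + 1 / x) * B"
    unfolding B_def by (subst qpoch_inf_Suc) (simp add: mult_ac)
  have "A > 0" "B > 0" "x > 0"
    unfolding A_def B_def x_def
    using q t qpoch_inf_neg_pos[of "q * t" "- c"] qpoch_inf_neg_inverse_pos[OF t, of "1 + c"] by simp_all
  have "q * ram_weight c q (q * t) = q * (q * t) powr (c - 1) / (A * ((1 + 1 / x) * B))"
    unfolding ram_weight_def A_def[symmetric] B by simp
  also have "\<dots> = q * (q * t) powr (c - 1) * x / ((1 + x) * A * B)"
    using \<open>A > 0\<close> \<open>B > 0\<close> \<open>x > 0\<close> by (simp add: field_simps)
  also have "q * (q * t) powr (c - 1) * x = t * t powr (c - 1)"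
    unfolding x_def using q t by (simp add: powr_mult powr_diff powr_minus field_simps power2_eq_square)
  finally show ?thesis
    unfolding ram_weight_def A B_def[symmetric] by simp
qed

text \<open>The same exchange of one factor between the two products, now with
  \<open>x = t q^(-c-1)\<close>. The weight changes only by a constant, which reduces its mass to
  the case \<open>0 \<le> c < 1\<close>.\<close>

lemma ram_weight_plus1:
  assumes t: "0 < t"
  shows "ram_weight (c + 1) q t = q powr (c + 1) * ram_weight c q t"
proof -
  define A where "A = qpoch_inf (- t * q powr (- c)) q"
  define B where "B = qpoch_inf (- (1 / t) * q powr (1 + (c + 1))) q"
  define x where "x = t * q powr (- (c + 1))"
  have e: "- t * q powr (- (c + 1)) = - x" "- x * q = - t * q powr (- c)"
    "- (1 / t) * q powr (1 + c) = - (1 / x)" "- (1 / x) * q = - (1 / t) * q powr (1 + (c + 1))"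
    unfolding x_def using q t
    by (simp_all add: powr_add powr_diff powr_minus field_simps power2_eq_square)
  have A: "qpoch_inf (- t * q powr (- (c + 1))) q = (1 + x) * A"
    using qpoch_inf_Suc[of "- x"] unfolding e A_def by simp
  have B: "qpoch_inf (- (1 / t) * q powr (1 + c)) q = (1 + 1 / x) * B"
    using qpoch_inf_Suc[of "- (1 / x)"] unfolding e B_def by simp
  have pos: "A > 0" "B > 0" "x > 0"
    unfolding A_def B_def x_def
    using q t qpoch_inf_neg_pos[OF t, of "- c"] qpoch_inf_neg_inverse_pos[OF t, of "1 + (c + 1)"] by simp_all
  have "ram_weight (c + 1) q t = t powr c / ((1 + x) * A * B)"
    unfolding ram_weight_def A B_def[symmetric] by simp
  also have "\<dots> = (t powr c / x) / (A * ((1 + 1 / x) * B))"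
    using pos by (simp add: field_simps)
  also have "t powr c / x = q powr (c + 1) * t powr (c - 1)"
    unfolding x_def using q t by (simp add: powr_add powr_diff powr_minus field_simps)
  finally show ?thesis
    unfolding ram_weight_def A_def[symmetric] B by simp
qed

lemma ram_moment_shift: "ram_moment c q s = ennreal (q powr s) * ram_moment c q (s + 1)"
proof -
  have "ram_moment c q s = ennreal q * (\<integral>\<^sup>+t. ennreal ((q * t) powr s * ram_weight c q (q * t)) \<partial>lpos)"
    unfolding ram_moment_def by (rule nn_integral_lpos_scale) (use q in auto)
  also have "\<dots> = (\<integral>\<^sup>+t. ennreal q * ennreal ((q * t) powr s * ram_weight c q (q * t)) \<partial>lpos)"
    by (rule nn_integral_cmult[symmetric]) (intro borel_measurable_lpos, measurable)
  also have "\<dots> = (\<integral>\<^sup>+t. ennreal (q powr s) * ennreal (t powr (s + 1) * ram_weight c q t) \<partial>lpos)"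
  proof (rule nn_integral_cong)
    fix t assume "t \<in> space lpos"
    then have t: "t > 0" by simp
    have "q * ((q * t) powr s * ram_weight c q (q * t)) = (q * t) powr s * (q * ram_weight c q (q * t))"
      by simp
    also have "\<dots> = q powr s * (t powr (s + 1) * ram_weight c q t)"
      unfolding ram_weight_scale[OF t] using q t by (simp add: powr_mult powr_add)
    finally show "ennreal q * ennreal ((q * t) powr s * ram_weight c q (q * t))
        = ennreal (q powr s) * ennreal (t powr (s + 1) * ram_weight c q t)"
      using q by (simp add: ennreal_mult'[symmetric])
  qed
  also have "\<dots> = ennreal (q powr s) * ram_moment c q (s + 1)"
    unfolding ram_moment_def by (rule nn_integral_cmult) (intro borel_measurable_lpos, measurable)
  finally show ?thesis .
qed

lemma ennreal_powr_mult: "ennreal (q powr x) * ennreal (q powr y) = ennreal (q powr (x + y))"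
  by (simp add: ennreal_mult'[symmetric] powr_add)

lemma ram_moment_int:
  "ram_moment c q (real_of_int k) = ennreal (q powr (- (k * (real_of_int k - 1) / 2))) * ram_moment c q 0"
proof (induction k rule: int_induct[where k = 0])
  case base
  then show ?case using q by simp
next
  case (step1 i)
  \<comment> \<open>Multiplication by the inverse power solves the shift relation for the next
    moment without dividing in \<open>ennreal\<close>.\<close>
  have "ennreal (q powr (- real_of_int i)) * ram_moment c q (real_of_int i)
      = ennreal (q powr (- real_of_int i)) * ennreal (q powr (real_of_int i)) * ram_moment c q (real_of_int i + 1)"
    by (subst ram_moment_shift) (simp add: mult.assoc)
  also have "ennreal (q powr (- real_of_int i)) * ennreal (q powr (real_of_int i)) = 1"
    using q by (simp add: ennreal_mult'[symmetric] powr_add[symmetric])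
  finally have "ram_moment c q (real_of_int i + 1)
      = ennreal (q powr (- real_of_int i)) * ennreal (q powr (- (i * (real_of_int i - 1) / 2))) * ram_moment c q 0"
    by (simp add: step1.IH mult.assoc)
  also have "ennreal (q powr (- real_of_int i)) * ennreal (q powr (- (i * (real_of_int i - 1) / 2)))
      = ennreal (q powr (- ((real_of_int i + 1) * (real_of_int i + 1 - 1) / 2)))"
    unfolding ennreal_powr_mult by (rule arg_cong[where f = "\<lambda>z. ennreal (q powr z)"]) (simp add: field_simps)
  finally show ?case by simp
next
  case (step2 i)
  have "ram_moment c q (real_of_int i - 1) = ennreal (q powr (real_of_int i - 1))
      * ennreal (q powr (- (i * (real_of_int i - 1) / 2))) * ram_moment c q 0"
    using ram_moment_shift[of c "real_of_int i - 1"] by (simp add: step2.IH mult.assoc)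
  also have "ennreal (q powr (real_of_int i - 1)) * ennreal (q powr (- (i * (real_of_int i - 1) / 2)))
      = ennreal (q powr (- ((real_of_int i - 1) * (real_of_int i - 1 - 1) / 2)))"
    unfolding ennreal_powr_mult by (rule arg_cong[where f = "\<lambda>z. ennreal (q powr z)"]) (simp add: field_simps)
  finally show ?case by simp
qed

section \<open>Termwise integration against the infinite products\<close>

text \<open>After Euler's expansion the term \<open>n\<close> involves the moment at
  \<open>s - n\<close>. Its Gaussian exponent removes the quadratic part of
  \<open>n (n - 1) / 2\<close>, leaving the powers of \<open>q powr (a + s)\<close>; these sum
  because \<open>a + s > 0\<close>. The exponent \<open>s\<close> is an integer because the moments
  are known there.\<close>

lemma nn_integral_ram_weight_single:
  fixes k :: int
  defines "s \<equiv> real_of_int k"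
  assumes as: "0 < a + s"
  shows "(\<integral>\<^sup>+t. ennreal (t powr s * ram_weight c q t * qpoch_inf (- (1 / t) * q powr (a + 1)) q) \<partial>lpos)
     = ram_moment c q 0 * ennreal (q powr (- (s * (s - 1) / 2)) / qpoch_inf (q powr (a + s)) q)"
proof -
  define e where "e n = q powr (n * (real n - 1) / 2) / qpoch q q n" for n
  have e0: "0 \<le> e n" for n
    unfolding e_def using qpoch_q_pos[OF q, of n] by simp
  note z = powr_less_one_of_pos[OF as]
  have "(\<integral>\<^sup>+t. ennreal (t powr s * ram_weight c q t * qpoch_inf (- (1 / t) * q powr (a + 1)) q) \<partial>lpos)
     = (\<integral>\<^sup>+t. (\<Sum>n. ennreal (e n * q powr (n * (a + 1))) * ennreal (t powr (s - n) * ram_weight c q t)) \<partial>lpos)"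
  proof (rule nn_integral_cong)
    fix t assume "t \<in> space lpos"
    then have t: "t > 0" by simp
    have "(\<lambda>n. t powr s * ram_weight c q t * (e n * (1 / t * q powr (a + 1)) ^ n)) sums
        (t powr s * ram_weight c q t * qpoch_inf (- (1 / t) * q powr (a + 1)) q)"
      using qpoch_inf_sums[OF q, of "1 / t * q powr (a + 1)"]
      unfolding e_def by (intro sums_mult) simp
    moreover have "t powr s * ram_weight c q t * (e n * (1 / t * q powr (a + 1)) ^ n)
        = (e n * q powr (n * (a + 1))) * (t powr (s - n) * ram_weight c q t)" for n
      using t q by (simp add: power_divide powr_diff powr_realpow powr_power field_simps)
    ultimately have sums: "(\<lambda>n. (e n * q powr (n * (a + 1))) * (t powr (s - n) * ram_weight c q t)) sums
        (t powr s * ram_weight c q t * qpoch_inf (- (1 / t) * q powr (a + 1)) q)"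
      by (simp only:)
    have "(\<Sum>n. ennreal (e n * q powr (n * (a + 1)) * (t powr (s - n) * ram_weight c q t)))
      = ennreal (t powr s * ram_weight c q t * qpoch_inf (- (1 / t) * q powr (a + 1)) q)"
      using e0 ram_weight_pos[OF t, of c] by (intro suminf_ennreal_eq[OF _ sums]) simp
    then show "ennreal (t powr s * ram_weight c q t * qpoch_inf (- (1 / t) * q powr (a + 1)) q)
      = (\<Sum>n. ennreal (e n * q powr (n * (a + 1))) * ennreal (t powr (s - n) * ram_weight c q t))"
      using e0 by (simp add: ennreal_mult'[symmetric])
  qed
  also have "\<dots> = (\<Sum>n. \<integral>\<^sup>+t. ennreal (e n * q powr (n * (a + 1))) * ennreal (t powr (s - n) * ram_weight c q t) \<partial>lpos)"
    by (rule nn_integral_suminf) (intro borel_measurable_lpos, measurable)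
  also have "\<dots> = (\<Sum>n. ennreal (e n * q powr (n * (a + 1))) * ram_moment c q (s - n))"
    unfolding ram_moment_def
    by (intro suminf_cong nn_integral_cmult borel_measurable_lpos) measurable
  also have "\<dots> = (\<Sum>n. ram_moment c q 0 * ennreal (q powr (- (s * (s - 1) / 2)) * (1 / qpoch q q n * (q powr (a + s)) ^ n)))"
  proof (rule suminf_cong)
    fix n :: nat
    have m: "ram_moment c q (s - n) = ennreal (q powr (- ((s - n) * (s - n - 1) / 2))) * ram_moment c q 0"
      using ram_moment_int[of c "k - int n"] by (simp add: s_def)
    have "q powr (n * (real n - 1) / 2) * q powr (n * (a + 1)) * q powr (- ((s - n) * (s - n - 1) / 2))
        = q powr (- (s * (s - 1) / 2)) * q powr (n * (a + s))"
      unfolding powr_add[symmetric] by (rule arg_cong[where f = "(powr) q"]) (simp add: field_simps)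
    then have "e n * q powr (n * (a + 1)) * q powr (- ((s - n) * (s - n - 1) / 2))
        = q powr (- (s * (s - 1) / 2)) * (1 / qpoch q q n * (q powr (a + s)) ^ n)"
      unfolding e_def using q by (simp add: powr_power mult.commute)
    then show "ennreal (e n * q powr (n * (a + 1))) * ram_moment c q (s - n)
      = ram_moment c q 0 * ennreal (q powr (- (s * (s - 1) / 2)) * (1 / qpoch q q n * (q powr (a + s)) ^ n))"
      unfolding m using e0 by (simp add: ennreal_mult'[symmetric] mult.assoc[symmetric])
        (simp add: mult.commute)
  qed
  also have "\<dots> = ram_moment c q 0 * (\<Sum>n. ennreal (q powr (- (s * (s - 1) / 2)) * (1 / qpoch q q n * (q powr (a + s)) ^ n)))"
    by (rule ennreal_suminf_cmult)
  also have "(\<Sum>n. ennreal (q powr (- (s * (s - 1) / 2)) * (1 / qpoch q q n * (q powr (a + s)) ^ n)))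
      = ennreal (q powr (- (s * (s - 1) / 2)) * (1 / qpoch_inf (q powr (a + s)) q))"
  proof (rule suminf_ennreal_eq)
    show "0 \<le> q powr (- (s * (s - 1) / 2)) * (1 / qpoch q q n * (q powr (a + s)) ^ n)" for n
      using qpoch_q_pos[OF q, of n] by simp
    show "(\<lambda>n. q powr (- (s * (s - 1) / 2)) * (1 / qpoch q q n * (q powr (a + s)) ^ n)) sums
       (q powr (- (s * (s - 1) / 2)) * (1 / qpoch_inf (q powr (a + s)) q))"
      \<comment> \<open>The q-binomial theorem with upper parameter 0 is Euler's series for the
        reciprocal of the infinite product.\<close>
      using qbinomial_sums[OF q, of "q powr (a + s)" 0] z
      by (intro sums_mult) (simp add: qpoch_def)
  qed
  finally show ?thesis by simp
qed

text \<open>Expanding the remaining product reduces to the previous integral at exponents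
  \<open>s + n\<close>. Again the quadratic exponents cancel, and the ratio of
  \<open>(q^(a+s); q)_inf\<close> to \<open>(q^(a+s+n); q)_inf\<close> supplies
  \<open>(q^(a+s); q)_n\<close>, so the result is a full q-binomial series in
  \<open>q powr (b - s)\<close>.\<close>

lemma nn_integral_ram_weight:
  fixes k :: int
  defines "s \<equiv> real_of_int k"
  assumes as: "0 < a + s" and bs: "0 < b - s"
  shows "(\<integral>\<^sup>+t. ennreal (t powr s * ram_weight c q t
            * (qpoch_inf (- t * q powr b) q * qpoch_inf (- (1 / t) * q powr (a + 1)) q)) \<partial>lpos)
     = ram_moment c q 0 * ennreal (q powr (- (s * (s - 1) / 2)) * qpoch_inf (q powr (a + b)) q
         / (qpoch_inf (q powr (a + s)) q * qpoch_inf (q powr (b - s)) q))"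
proof -
  note [measurable] = borel_measurable_qpoch_inf[OF q]
  define e where "e n = q powr (n * (real n - 1) / 2) / qpoch q q n" for n
  have e0: "0 \<le> e n" for n
    unfolding e_def using qpoch_q_pos[OF q, of n] by simp
  define W where "W t = ram_weight c q t * qpoch_inf (- (1 / t) * q powr (a + 1)) q" for t
  have [measurable]: "W \<in> borel_measurable borel"
    unfolding W_def by measurable
  note z = powr_less_one_of_pos[OF as]
  note z' = powr_less_one_of_pos[OF bs]
  define P where "P = qpoch_inf (q powr (a + s)) q"
  have P: "0 < P" unfolding P_def by (rule qpoch_inf_pos[OF q z])
  have "(\<integral>\<^sup>+t. ennreal (t powr s * ram_weight c q t
            * (qpoch_inf (- t * q powr b) q * qpoch_inf (- (1 / t) * q powr (a + 1)) q)) \<partial>lpos)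
     = (\<integral>\<^sup>+t. (\<Sum>n. ennreal (e n * q powr (n * b)) * ennreal (t powr (s + n) * W t)) \<partial>lpos)"
  proof (rule nn_integral_cong)
    fix t assume "t \<in> space lpos"
    then have t: "t > 0" by simp
    have W: "0 < W t"
      unfolding W_def by (intro mult_pos_pos ram_weight_pos qpoch_inf_neg_inverse_pos t)
    have "(\<lambda>n. t powr s * W t * (e n * (t * q powr b) ^ n)) sums
        (t powr s * W t * qpoch_inf (- t * q powr b) q)"
      using qpoch_inf_sums[OF q, of "t * q powr b"]
      unfolding e_def by (intro sums_mult) simp
    moreover have "t powr s * W t * (e n * (t * q powr b) ^ n)
        = (e n * q powr (n * b)) * (t powr (s + n) * W t)" for n
      using t q by (simp add: power_mult_distrib powr_add powr_realpow powr_power field_simps)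
    ultimately have sums: "(\<lambda>n. (e n * q powr (n * b)) * (t powr (s + n) * W t)) sums
        (t powr s * W t * qpoch_inf (- t * q powr b) q)"
      by (simp only:)
    have "(\<Sum>n. ennreal (e n * q powr (n * b) * (t powr (s + n) * W t)))
      = ennreal (t powr s * W t * qpoch_inf (- t * q powr b) q)"
      using e0 W by (intro suminf_ennreal_eq[OF _ sums]) simp
    then show "ennreal (t powr s * ram_weight c q t
            * (qpoch_inf (- t * q powr b) q * qpoch_inf (- (1 / t) * q powr (a + 1)) q))
      = (\<Sum>n. ennreal (e n * q powr (n * b)) * ennreal (t powr (s + n) * W t))"
      using e0 by (simp add: ennreal_mult'[symmetric] W_def mult_ac)
  qed
  also have "\<dots> = (\<Sum>n. \<integral>\<^sup>+t. ennreal (e n * q powr (n * b)) * ennreal (t powr (s + n) * W t) \<partial>lpos)"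
    by (rule nn_integral_suminf) (intro borel_measurable_lpos, measurable)
  also have "\<dots> = (\<Sum>n. ennreal (e n * q powr (n * b)) * (\<integral>\<^sup>+t. ennreal (t powr (s + n) * W t) \<partial>lpos))"
    by (intro suminf_cong nn_integral_cmult borel_measurable_lpos) measurable
  also have "\<dots> = (\<Sum>n. ram_moment c q 0 * ennreal (q powr (- (s * (s - 1) / 2)) / P
      * (qpoch (q powr (a + s)) q n / qpoch q q n * (q powr (b - s)) ^ n)))"
  proof (rule suminf_cong)
    fix n :: nat
    define Pn where "Pn = qpoch_inf (q powr (a + (s + n))) q"
    define D where "D = qpoch (q powr (a + s)) q n"
    have "q powr (a + s) * q ^ n = q powr (a + (s + n))"
      using q by (simp add: powr_add powr_realpow)
    then have PD: "P = D * Pn"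
      unfolding P_def D_def Pn_def using qpoch_inf_split[OF q, of "q powr (a + s)" n] by simp
    have "0 < D" unfolding D_def by (rule qpoch_pos[OF q z])
    have "0 < Pn" using PD P \<open>0 < D\<close> by (simp add: zero_less_mult_iff)
    have m: "(\<integral>\<^sup>+t. ennreal (t powr (s + n) * W t) \<partial>lpos)
        = ram_moment c q 0 * ennreal (q powr (- ((s + n) * (s + n - 1) / 2)) / Pn)"
      using nn_integral_ram_weight_single[of a "k + int n" c] as by (simp add: s_def W_def Pn_def mult_ac)
    have "q powr (n * (real n - 1) / 2) * q powr (n * b) * q powr (- ((s + n) * (s + n - 1) / 2))
        = q powr (- (s * (s - 1) / 2)) * q powr (n * (b - s))"
      unfolding powr_add[symmetric] by (rule arg_cong[where f = "(powr) q"]) (simp add: field_simps)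
    then have "e n * q powr (n * b) * (q powr (- ((s + n) * (s + n - 1) / 2)) / Pn)
        = q powr (- (s * (s - 1) / 2)) / P * (D / qpoch q q n * (q powr (b - s)) ^ n)"
      unfolding e_def PD using q \<open>0 < D\<close> by (simp add: powr_power mult.commute)
    then show "ennreal (e n * q powr (n * b)) * (\<integral>\<^sup>+t. ennreal (t powr (s + n) * W t) \<partial>lpos)
      = ram_moment c q 0 * ennreal (q powr (- (s * (s - 1) / 2)) / P
      * (qpoch (q powr (a + s)) q n / qpoch q q n * (q powr (b - s)) ^ n))"
      unfolding m D_def using e0 \<open>0 < Pn\<close>
      by (simp add: mult.left_commute[of _ "ram_moment c q 0"] ennreal_mult'[symmetric])
  qed
  also have "\<dots> = ram_moment c q 0 * (\<Sum>n. ennreal (q powr (- (s * (s - 1) / 2)) / P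
      * (qpoch (q powr (a + s)) q n / qpoch q q n * (q powr (b - s)) ^ n)))"
    by (rule ennreal_suminf_cmult)
  also have "(\<Sum>n. ennreal (q powr (- (s * (s - 1) / 2)) / P
      * (qpoch (q powr (a + s)) q n / qpoch q q n * (q powr (b - s)) ^ n)))
      = ennreal (q powr (- (s * (s - 1) / 2)) / P
         * (qpoch_inf (q powr (a + s) * q powr (b - s)) q / qpoch_inf (q powr (b - s)) q))"
  proof (rule suminf_ennreal_eq)
    show "0 \<le> q powr (- (s * (s - 1) / 2)) / P
      * (qpoch (q powr (a + s)) q n / qpoch q q n * (q powr (b - s)) ^ n)" for n
      using qpoch_q_pos[OF q, of n] qpoch_pos[OF q z, of n] P by simp
    show "(\<lambda>n. q powr (- (s * (s - 1) / 2)) / P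
      * (qpoch (q powr (a + s)) q n / qpoch q q n * (q powr (b - s)) ^ n)) sums
       (q powr (- (s * (s - 1) / 2)) / P
         * (qpoch_inf (q powr (a + s) * q powr (b - s)) q / qpoch_inf (q powr (b - s)) q))"
      using qbinomial_sums[OF q, of "q powr (b - s)" "q powr (a + s)"] z'
      by (intro sums_mult) simp
  qed
  also have "q powr (a + s) * q powr (b - s) = q powr (a + b)"
    by (simp add: powr_add[symmetric])
  finally show ?thesis by (simp add: P_def)
qed

section \<open>The Gamma quotient and the total mass of the weight\<close>

lemma nn_integral_partial_fraction:
  "(\<integral>\<^sup>+t. ennreal (1 / ((1 + t) * (t + q))) \<partial>lpos) = ennreal (- ln q / (1 - q))"
proof -
  define F where "F t = ln ((t + q) / (1 + t)) / (1 - q)" for t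
  have "(\<integral>\<^sup>+t. ennreal (1 / ((1 + t) * (t + q))) \<partial>lpos)
      = (\<integral>\<^sup>+t. ennreal (1 / ((1 + t) * (t + q))) * indicator {0<..} t \<partial>lborel)"
    by (simp add: nn_integral_restrict_space)
  also have "\<dots> = (\<integral>\<^sup>+t. ennreal (1 / ((1 + t) * (t + q))) * indicator {0..} t \<partial>lborel)"
  proof (rule nn_integral_cong_AE)
    have "AE t in lborel. t \<noteq> (0::real)" by (rule AE_lborel_singleton)
    then show "AE t in lborel. ennreal (1 / ((1 + t) * (t + q))) * indicator {0<..} t
        = ennreal (1 / ((1 + t) * (t + q))) * indicator {0..} t"
      by eventually_elim (auto simp: indicator_def)
  qed
  also have "\<dots> = ennreal (0 - F 0)"
  proof (rule nn_integral_FTC_atLeast)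
    show "(\<lambda>t. 1 / ((1 + t) * (t + q))) \<in> borel_measurable borel" by measurable
    show "(F has_real_derivative 1 / ((1 + t) * (t + q))) (at t)" if "0 \<le> t" for t
    proof -
      have pos: "0 < t + q" "0 < 1 + t" "0 < 1 - q" using that q by auto
      have "((\<lambda>t. (ln (t + q) - ln (1 + t)) / (1 - q)) has_real_derivative
          (1 / (t + q) - 1 / (1 + t)) / (1 - q)) (at t)"
        using pos by (auto intro!: derivative_eq_intros)
      moreover have "(1 / (t + q) - 1 / (1 + t)) / (1 - q) = 1 / ((1 + t) * (t + q))"
      proof -
        have "1 / (t + q) - 1 / (1 + t) = (1 - q) / ((1 + t) * (t + q))"
          using pos by (simp add: field_simps)
        then show ?thesis using pos by simp
      qed
      \<comment> \<open>The difference of logarithms is convenient to differentiate, the logarithm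
        of the quotient has an evident limit at infinity; they agree near \<open>t\<close>.\<close>
      moreover have "eventually (\<lambda>t. 0 < t + q \<and> 0 < 1 + t) (nhds t)"
        by (intro eventually_conj order_tendstoD(1)[where y = "t + q"] order_tendstoD(1)[where y = "1 + t"] tendsto_intros filterlim_ident)
           (use pos in auto)
      then have "eventually (\<lambda>t. (ln (t + q) - ln (1 + t)) / (1 - q) = F t) (nhds t)"
        by eventually_elim (simp add: F_def ln_div)
      ultimately show ?thesis by (simp add: DERIV_cong_ev)
    qed
    show "0 \<le> 1 / ((1 + t) * (t + q))" if "0 \<le> t" for t using that q by simp
    have lim: "((\<lambda>t. (t + q) / (1 + t)) \<longlongrightarrow> 1) at_top"
    proof -
      have "((\<lambda>t. 1 - (1 - q) / (1 + t)) \<longlongrightarrow> 1 - 0) at_top"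
        by (intro tendsto_diff tendsto_const tendsto_divide_0[OF tendsto_const]
            filterlim_at_top_imp_at_infinity filterlim_tendsto_add_at_top[OF tendsto_const] filterlim_ident)
      moreover have "eventually (\<lambda>t. 1 - (1 - q) / (1 + t) = (t + q) / (1 + t)) at_top"
        using eventually_gt_at_top[of 0] by eventually_elim (simp add: field_simps)
      ultimately show ?thesis by (simp add: filterlim_cong)
    qed
    have "(F \<longlongrightarrow> ln 1 / (1 - q)) at_top"
      unfolding F_def by (intro tendsto_divide tendsto_ln lim tendsto_const) (use q in auto)
    then show "(F \<longlongrightarrow> 0) at_top" by simp
  qed
  finally show ?thesis by (simp add: F_def)
qed

lemma gamma_ratio_eq:
  "gamma_ratio q x = (1 - q) * (qpoch_inf q q)\<^sup>2
     / (qpoch_inf (q powr x) q * qpoch_inf (q powr (1 - x)) q * (Gamma x * Gamma (1 - x)))"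
proof -
  have "(1 - q) powr (1 - x) * (1 - q) powr (1 - (1 - x)) = 1 - q"
    using q by (simp add: powr_add[symmetric])
  then show ?thesis
    unfolding gamma_ratio_def Gamma_q_def by (simp add: power2_eq_square mult_ac)
qed

lemma Gamma_quot_eq: "Gamma_quot q c = (if c \<in> \<int> then Lim (at c) (gamma_ratio q) else gamma_ratio q c)"
  unfolding Gamma_quot_def gamma_ratio_def[abs_def] by simp

text \<open>Off the integers, the sign in \<open>1 - q^(-x) = -(1 - q^x) / q^x\<close> is offset by
  that in \<open>Gamma (1 - x) = - x * Gamma (- x)\<close>. At integers both sides are 0 by
  convention, so the relation may be rewritten under a limit.\<close>

lemma gamma_ratio_plus1: "gamma_ratio q (x + 1) = q powr x * gamma_ratio q x"
proof (cases "x \<in> \<int>")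
  case True
  then obtain n where n: "x = of_int n" by (elim Ints_cases)
  have 0: "Gamma y * Gamma (1 - y) = 0" if "y = of_int m" for y :: real and m
  proof (cases "m \<le> 0")
    case True
    then have "y \<in> \<int>\<^sub>\<le>\<^sub>0" unfolding that by (simp add: nonpos_Ints_of_int)
    then show ?thesis by (simp add: Gamma_eq_zero_iff)
  next
    case False
    then have "real_of_int (1 - m) \<in> \<int>\<^sub>\<le>\<^sub>0" by (intro nonpos_Ints_of_int) simp
    then have "1 - y \<in> \<int>\<^sub>\<le>\<^sub>0" unfolding that by simp
    then show ?thesis by (simp add: Gamma_eq_zero_iff)
  qed
  have "Gamma x * Gamma (1 - x) = 0" "Gamma (x + 1) * Gamma (1 - (x + 1)) = 0"
    by (rule 0[of _ n], simp add: n, rule 0[of _ "n + 1"], simp add: n)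
  then show ?thesis
    unfolding gamma_ratio_eq by (simp only: mult_zero_right div_by_0)
next
  case False
  then have "- x \<notin> \<int>" "x \<noteq> 0" by auto
  with False have "x \<notin> \<int>\<^sub>\<le>\<^sub>0" "- x \<notin> \<int>\<^sub>\<le>\<^sub>0" by (auto dest: nonpos_Ints_Int)
  then have G: "Gamma (x + 1) = x * Gamma x" "Gamma (1 - x) = - x * Gamma (- x)"
    using Gamma_plus1[of x] Gamma_plus1[of "- x"] by (simp_all add: add.commute)
  define A where "A = qpoch_inf (q powr (x + 1)) q"
  define B where "B = qpoch_inf (q powr (1 - x)) q"
  have A: "qpoch_inf (q powr x) q = (1 - q powr x) * A"
    unfolding A_def using qpoch_inf_Suc[of "q powr x"] q by (simp add: powr_add)
  have B: "qpoch_inf (q powr (1 - (x + 1))) q = (1 - q powr (- x)) * B"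
    unfolding B_def using qpoch_inf_Suc[of "q powr (- x)"] q by (simp add: powr_diff powr_minus field_simps)
  have y: "1 - q powr (- x) = - ((1 - q powr x) / q powr x)"
    using q by (simp add: powr_minus field_simps)
  show ?thesis
    unfolding gamma_ratio_eq A B A_def[symmetric] B_def[symmetric] G y
    using \<open>x \<noteq> 0\<close> by (simp add: mult_ac)
qed

lemma one_minus_powr_over_tendsto: "((\<lambda>x. (1 - q powr x) / x) \<longlongrightarrow> - ln q) (at 0)"
proof -
  have "((\<lambda>x. 1 - q powr x) has_real_derivative - ln q) (at 0)"
    using q by (auto intro!: derivative_eq_intros)
  then show ?thesis using q by (simp add: has_field_derivative_iff)
qed

lemma gamma_ratio_tendsto_0: "(gamma_ratio q \<longlongrightarrow> (1 - q) / - ln q) (at 0)"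
proof -
  have P: "((\<lambda>x. qpoch_inf (f x) q) \<longlongrightarrow> qpoch_inf y q) (at 0)" if "(f \<longlongrightarrow> y) (at 0)" for f and y
    by (rule isCont_tendsto_compose[OF isCont_qpoch_inf[OF q] that])
  have Pq: "qpoch_inf q q > 0" by (intro qpoch_inf_pos q)
  have lq: "ln q < 0" using q by simp
  \<comment> \<open>Here the zero factor \<open>1 - q^x\<close> is paired with the pole of
    \<open>Gamma x = Gamma (x + 1) / x\<close>, which leaves a quotient tending to
    \<open>- ln q\<close>.\<close>
  define h where "h x = (1 - q) * (qpoch_inf q q)\<^sup>2
     / ((1 - q powr x) / x * qpoch_inf (q powr (x + 1)) q * qpoch_inf (q powr (1 - x)) q * (Gamma (x + 1) * Gamma (1 - x)))" for x
  have "(h \<longlongrightarrow> (1 - q) * (qpoch_inf q q)\<^sup>2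
     / (- ln q * qpoch_inf (q powr (0 + 1)) q * qpoch_inf (q powr (1 - 0)) q * (Gamma (0 + 1) * Gamma (1 - 0)))) (at 0)"
    unfolding h_def using q Pq lq
    by (intro tendsto_intros P one_minus_powr_over_tendsto) auto
  then have "(h \<longlongrightarrow> (1 - q) / - ln q) (at 0)"
    using q Pq by (simp add: power2_eq_square)
  moreover have "eventually (\<lambda>x. x \<in> {-1<..<1} \<and> x \<noteq> 0) (at (0::real))"
    by (intro eventually_conj eventually_neq_at_within eventually_at_in_open') auto
  then have "eventually (\<lambda>x. h x = gamma_ratio q x) (at 0)"
  proof eventually_elim
    case (elim x)
    have "x \<notin> \<int>\<^sub>\<le>\<^sub>0"
      using elim by (auto elim!: nonpos_Ints_cases)
    then have G: "Gamma (x + 1) = x * Gamma x" by (rule Gamma_plus1)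
    have A: "qpoch_inf (q powr x) q = (1 - q powr x) * qpoch_inf (q powr (x + 1)) q"
      using qpoch_inf_Suc[of "q powr x"] q by (simp add: powr_add)
    show ?case unfolding h_def gamma_ratio_eq G A using elim by simp
  qed
  ultimately show ?thesis by (simp add: filterlim_cong)
qed

text \<open>The shift relation transports the limit at 0 to every integer, contributing one factor
  \<open>q^i\<close> per step.\<close>

lemma gamma_ratio_tendsto_int:
  "(gamma_ratio q \<longlongrightarrow> q powr (k * (real_of_int k - 1) / 2) * ((1 - q) / - ln q)) (at (real_of_int k))"
proof (induction k rule: int_induct[where k = 0])
  case base
  then show ?case using gamma_ratio_tendsto_0 q by simp
next
  case (step1 i)
  have "((\<lambda>x. q powr x * gamma_ratio q x) \<longlongrightarrow> q powr i
     * (q powr (i * (real_of_int i - 1) / 2) * ((1 - q) / - ln q))) (at (real_of_int i))"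
    using q by (intro tendsto_mult step1.IH tendsto_intros) auto
  also have "q powr i * (q powr (i * (real_of_int i - 1) / 2) * ((1 - q) / - ln q))
     = q powr (real_of_int (i + 1) * (real_of_int (i + 1) - 1) / 2) * ((1 - q) / - ln q)"
    unfolding mult.assoc[symmetric] powr_add[symmetric]
    by (rule arg_cong[where f = "\<lambda>z. q powr z * ((1 - q) / - ln q)"]) (simp add: field_simps)
  finally have "((\<lambda>x. gamma_ratio q (x + 1)) \<longlongrightarrow> q powr (real_of_int (i + 1) * (real_of_int (i + 1) - 1) / 2)
     * ((1 - q) / - ln q)) (at (real_of_int i))"
    unfolding gamma_ratio_plus1 .
  then show ?case
    using LIM_offset[of "\<lambda>x. gamma_ratio q (x + 1)" _ "real_of_int i" "-1"] by (simp add: algebra_simps)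
next
  case (step2 i)
  have "((\<lambda>x. gamma_ratio q (x + 1)) \<longlongrightarrow> q powr (i * (real_of_int i - 1) / 2) * ((1 - q) / - ln q)) (at (real_of_int i - 1))"
    using LIM_offset[OF step2.IH, of 1] by simp
  then have "((\<lambda>x. q powr (- x) * gamma_ratio q (x + 1)) \<longlongrightarrow> q powr (- (real_of_int i - 1))
     * (q powr (i * (real_of_int i - 1) / 2) * ((1 - q) / - ln q))) (at (real_of_int i - 1))"
    using q by (intro tendsto_mult tendsto_intros) auto
  also have "q powr (- (real_of_int i - 1)) * (q powr (i * (real_of_int i - 1) / 2) * ((1 - q) / - ln q))
     = q powr (real_of_int (i - 1) * (real_of_int (i - 1) - 1) / 2) * ((1 - q) / - ln q)"
    unfolding mult.assoc[symmetric] powr_add[symmetric]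
    by (rule arg_cong[where f = "\<lambda>z. q powr z * ((1 - q) / - ln q)"]) (simp add: field_simps)
  also have "(\<lambda>x. q powr (- x) * gamma_ratio q (x + 1)) = gamma_ratio q"
    unfolding gamma_ratio_plus1 using q by (simp add: powr_minus_divide)
  finally show ?case by simp
qed

lemma Gamma_quot_int: "Gamma_quot q (real_of_int k) = q powr (k * (real_of_int k - 1) / 2) * ((1 - q) / - ln q)"
  unfolding Gamma_quot_eq using tendsto_Lim[OF _ gamma_ratio_tendsto_int[of k]] by simp

lemma Gamma_quot_plus1: "Gamma_quot q (c + 1) = q powr c * Gamma_quot q c"
proof (cases "c \<in> \<int>")
  case True
  then obtain k where k: "c = of_int k" by (elim Ints_cases)
  have "q powr (real_of_int (k + 1) * (real_of_int (k + 1) - 1) / 2) = q powr k * q powr (k * (real_of_int k - 1) / 2)"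
    unfolding powr_add[symmetric] by (rule arg_cong[where f = "(powr) q"]) (simp add: field_simps)
  then show ?thesis
    using Gamma_quot_int[of k] Gamma_quot_int[of "k + 1"] by (simp add: k)
next
  case False
  moreover from False have "c + 1 \<notin> \<int>" using Ints_diff[of "c + 1" 1] by auto
  ultimately show ?thesis by (simp add: Gamma_quot_eq gamma_ratio_plus1)
qed

lemma ram_moment_plus1: "ram_moment (c + 1) q s = ennreal (q powr (c + 1)) * ram_moment c q s"
proof -
  have "ram_moment (c + 1) q s = (\<integral>\<^sup>+t. ennreal (q powr (c + 1)) * ennreal (t powr s * ram_weight c q t) \<partial>lpos)"
    unfolding ram_moment_def
    by (intro nn_integral_cong) (simp add: ram_weight_plus1 ennreal_mult'[symmetric] mult_ac)
  also have "\<dots> = ennreal (q powr (c + 1)) * ram_moment c q s"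
    unfolding ram_moment_def by (intro nn_integral_cmult borel_measurable_lpos) measurable
  finally show ?thesis .
qed

lemma ram_mass_plus1: "ram_mass q (c + 1) = q powr (c + 1) * ram_mass q c"
proof -
  have "q powr (c + 1)\<^sup>2 = q powr (c + 1) * q powr c * q powr c\<^sup>2"
    unfolding powr_add[symmetric] by (rule arg_cong[where f = "(powr) q"]) (simp add: power2_eq_square field_simps)
  then show ?thesis using q by (simp add: ram_mass_def Gamma_quot_plus1)
qed

lemma ram_moment_0_base:
  assumes c: "0 \<le> c" "c < 1"
  shows "Gamma_quot q c > 0 \<and> ram_moment c q 0 = ennreal (ram_mass q c)"
proof (cases "c = 0")
  case True
  have G: "Gamma_quot q c = (1 - q) / - ln q"
    using Gamma_quot_int[of 0] q True by simp
  define P where "P = qpoch_inf (q * q) q"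
  have P: "0 < P" unfolding P_def using q mult_strict_mono[of q 1 q 1] by (intro qpoch_inf_pos q) simp
  have Pq: "qpoch_inf q q = (1 - q) * P"
    unfolding P_def by (rule qpoch_inf_Suc)
  \<comment> \<open>With \<open>a = b = 1\<close> each numerator product cancels its denominator up
    to the first factor, so the integrand is rational.\<close>
  have "ram_moment c q 0 * ennreal (P / (qpoch_inf q q * qpoch_inf q q))
     = (\<integral>\<^sup>+t. ennreal (ram_weight 0 q t
            * (qpoch_inf (- t * q powr 1) q * qpoch_inf (- (1 / t) * q powr (1 + 1)) q)) \<partial>lpos)"
    using nn_integral_ram_weight[of 1 0 1 c] q True
    by (simp add: P_def powr_add[symmetric, of q 1 1, simplified] cong: nn_integral_cong_simp)
  also have "\<dots> = (\<integral>\<^sup>+t. ennreal (1 / ((1 + t) * (t + q))) \<partial>lpos)"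
  proof (rule nn_integral_cong)
    fix t assume "t \<in> space lpos"
    then have t: "t > 0" by simp
    define A where "A = qpoch_inf (- t * q) q"
    define B where "B = qpoch_inf (- (q / t) * q) q"
    have pos: "0 < A" "0 < B"
    proof -
      have "0 < t * q" "0 < q / t * q" using t q by auto
      then show "0 < A" "0 < B"
        unfolding A_def B_def by (intro qpoch_inf_pos q; linarith)+
    qed
    have "qpoch_inf (- t) q = (1 + t) * A" "qpoch_inf (- (q / t)) q = (1 + q / t) * B"
      unfolding A_def B_def using qpoch_inf_Suc[of "- t"] qpoch_inf_Suc[of "- (q / t)"] by simp_all
    moreover have "ram_weight 0 q t = 1 / t / (qpoch_inf (- t) q * qpoch_inf (- (q / t)) q)"
      unfolding ram_weight_def using q t by (simp add: powr_minus_divide)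
    moreover have "qpoch_inf (- t * q powr 1) q = A" "qpoch_inf (- (1 / t) * q powr (1 + 1)) q = B"
      unfolding A_def B_def using q by (simp_all add: powr_add[symmetric, of q 1 1, simplified])
    ultimately have "ram_weight 0 q t * (qpoch_inf (- t * q powr 1) q * qpoch_inf (- (1 / t) * q powr (1 + 1)) q)
       = 1 / t / ((1 + t) * A * ((1 + q / t) * B)) * (A * B)" by simp
    also have "\<dots> = 1 / ((1 + t) * (t * (1 + q / t)))"
      using pos by simp
    also have "t * (1 + q / t) = t + q" using t by (simp add: field_simps)
    finally show "ennreal (ram_weight 0 q t * (qpoch_inf (- t * q powr 1) q * qpoch_inf (- (1 / t) * q powr (1 + 1)) q))
       = ennreal (1 / ((1 + t) * (t + q)))" by simp
  qed
  also have "\<dots> = ennreal (- ln q / (1 - q))" by (rule nn_integral_partial_fraction)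
  finally have "ram_moment c q 0 = ennreal ((- ln q / (1 - q)) / (P / (qpoch_inf q q * qpoch_inf q q)))"
    by (rule ennreal_eq_divideI) (use P Pq q in \<open>simp_all add: divide_nonpos_pos\<close>)
  also have "(- ln q / (1 - q)) / (P / (qpoch_inf q q * qpoch_inf q q)) = ram_mass q c"
    unfolding ram_mass_def G Pq using P q True by (simp add: field_simps)
  finally show ?thesis using q by (simp add: G divide_pos_neg)
next
  case False
  with c have c: "0 < c" "c < 1" by auto
  have "c \<notin> \<int>" using c by (auto elim!: Ints_cases)
  then have G: "Gamma_quot q c = (1 - q) * (qpoch_inf q q)\<^sup>2
     / (qpoch_inf (q powr c) q * qpoch_inf (q powr (1 - c)) q * (Gamma c * Gamma (1 - c)))"
    by (simp add: Gamma_quot_eq gamma_ratio_eq)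
  have l1: "q powr c < 1" "q powr (1 - c) < 1"
    using powr_less_mono2[of c q 1] powr_less_mono2[of "1 - c" q 1] c q by auto
  have pos: "0 < qpoch_inf q q" "0 < qpoch_inf (q powr c) q" "0 < qpoch_inf (q powr (1 - c)) q"
    "0 < Gamma c" "0 < Gamma (1 - c)"
    using c l1 by (auto intro!: qpoch_inf_pos q)
  \<comment> \<open>The choice \<open>a = c\<close>, \<open>b = 1 - c\<close> cancels the second
    products completely and leaves one factor of the first. The positivity conditions on
    \<open>a\<close> and \<open>b\<close> require \<open>0 < c < 1\<close>, hence the separate case
    \<open>c = 0\<close>.\<close>
  have "ram_moment c q 0 * ennreal (qpoch_inf q q / (qpoch_inf (q powr c) q * qpoch_inf (q powr (1 - c)) q))
     = (\<integral>\<^sup>+t. ennreal (t powr 0 * ram_weight c q t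
            * (qpoch_inf (- t * q powr (1 - c)) q * qpoch_inf (- (1 / t) * q powr (c + 1)) q)) \<partial>lpos)"
    using nn_integral_ram_weight[of c 0 "1 - c" c] c q by simp
  also have "\<dots> = (\<integral>\<^sup>+t. ennreal (t powr (c - 1) / (1 + t * q powr (- c))) \<partial>lpos)"
  proof (rule nn_integral_cong)
    fix t assume "t \<in> space lpos"
    then have t: "t > 0" by simp
    define A where "A = qpoch_inf (- t * q powr (1 - c)) q"
    define B where "B = qpoch_inf (- (1 / t) * q powr (c + 1)) q"
    have pos: "0 < A" "0 < B"
      unfolding A_def B_def by (intro qpoch_inf_neg_pos qpoch_inf_neg_inverse_pos q t)+
    have A: "qpoch_inf (- t * q powr (- c)) q = (1 + t * q powr (- c)) * A"
      unfolding A_def using qpoch_inf_Suc[of "- t * q powr (- c)"] q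
      by (simp add: powr_diff powr_minus field_simps)
    have B: "qpoch_inf (- (1 / t) * q powr (1 + c)) q = B"
      by (simp add: B_def add.commute)
    have "t powr 0 * ram_weight c q t * (A * B) = t powr (c - 1) / (1 + t * q powr (- c))"
      unfolding ram_weight_def A B using pos t by simp
    then show "ennreal (t powr 0 * ram_weight c q t
            * (qpoch_inf (- t * q powr (1 - c)) q * qpoch_inf (- (1 / t) * q powr (c + 1)) q))
       = ennreal (t powr (c - 1) / (1 + t * q powr (- c)))"
      unfolding A_def B_def by (rule arg_cong)
  qed
  \<comment> \<open>Scaling by \<open>q^c\<close> turns the denominator into \<open>1 + t\<close>;
    the collected powers are \<open>q^c q^(c(c-1)) = q^(c^2)\<close>.\<close>
  also have "\<dots> = ennreal (q powr c) * (\<integral>\<^sup>+t. ennreal ((q powr c * t) powr (c - 1) / (1 + (q powr c * t) * q powr (- c))) \<partial>lpos)"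
    by (rule nn_integral_lpos_scale) (use q in auto)
  also have "\<dots> = ennreal (q powr c) * (\<integral>\<^sup>+t. ennreal (q powr (c * (c - 1))) * ennreal (t powr (c - 1) / (1 + t)) \<partial>lpos)"
  proof (intro arg_cong2[where f = "(*)"] nn_integral_cong refl)
    fix t assume "t \<in> space lpos"
    then have t: "t > 0" by simp
    have "q powr c * t * q powr (- c) = t" using q by (simp add: powr_minus)
    then show "ennreal ((q powr c * t) powr (c - 1) / (1 + (q powr c * t) * q powr (- c)))
       = ennreal (q powr (c * (c - 1))) * ennreal (t powr (c - 1) / (1 + t))"
      using t q by (simp add: powr_mult powr_powr ennreal_mult'[symmetric])
  qed
  also have "\<dots> = ennreal (q powr c) * (ennreal (q powr (c * (c - 1))) * (\<integral>\<^sup>+t. ennreal (t powr (c - 1) / (1 + t)) \<partial>lpos))"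
    by (subst nn_integral_cmult) (intro borel_measurable_lpos, measurable)
  also have "\<dots> = ennreal (q powr c * q powr (c * (c - 1)) * (Gamma c * Gamma (1 - c)))"
    unfolding nn_integral_beta_prime[OF c] by (simp add: ennreal_mult'[symmetric] mult.assoc)
  also have "q powr c * q powr (c * (c - 1)) = q powr c\<^sup>2"
    unfolding powr_add[symmetric] by (rule arg_cong[where f = "(powr) q"]) (simp add: power2_eq_square field_simps)
  finally have "ram_moment c q 0 = ennreal (q powr c\<^sup>2 * (Gamma c * Gamma (1 - c))
     / (qpoch_inf q q / (qpoch_inf (q powr c) q * qpoch_inf (q powr (1 - c)) q)))"
    by (rule ennreal_eq_divideI) (use pos in auto)
  also have "q powr c\<^sup>2 * (Gamma c * Gamma (1 - c))
     / (qpoch_inf q q / (qpoch_inf (q powr c) q * qpoch_inf (q powr (1 - c)) q)) = ram_mass q c"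
    unfolding ram_mass_def G using pos q by (simp add: power2_eq_square)
  finally show ?thesis using pos q by (simp add: G)
qed

lemma ram_moment_0: "Gamma_quot q c > 0" "ram_moment c q 0 = ennreal (ram_mass q c)"
proof -
  define P where "P c \<longleftrightarrow> Gamma_quot q c > 0 \<and> ram_moment c q 0 = ennreal (ram_mass q c)" for c
  \<comment> \<open>The moment and its closed form acquire the same factor, positive and finite, so
    it cancels in \<open>ennreal\<close>. The equivalence serves both directions of the integer
    induction that starts from \<open>frac c\<close>.\<close>
  have step: "P (c + 1) \<longleftrightarrow> P c" for c
  proof -
    have "ennreal (q powr (c + 1)) * x = ennreal (q powr (c + 1)) * y \<longleftrightarrow> x = y" for x y
      using q by (intro ennreal_mult_cancel_left[THEN trans]) auto
    then show ?thesis
      unfolding P_def Gamma_quot_plus1 ram_moment_plus1 ram_mass_plus1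
      using q by (simp add: ennreal_mult' zero_less_mult_iff)
  qed
  have "P (frac c + of_int k)" for k
  proof (induction k rule: int_induct[where k = 0])
    case base
    show ?case using ram_moment_0_base[of "frac c"] by (simp add: P_def frac_ge_0 frac_lt_1)
  next
    case (step1 i)
    then show ?case using step[of "frac c + of_int i"] by (simp add: add_ac)
  next
    case (step2 i)
    then show ?case using step[of "frac c + of_int (i - 1)"] by (simp add: add_ac)
  qed
  from this[of "\<lfloor>c\<rfloor>"] show "Gamma_quot q c > 0" "ram_moment c q 0 = ennreal (ram_mass q c)"
    by (simp_all add: P_def frac_def)
qed

lemma ram_mass_pos: "0 < ram_mass q c"
  unfolding ram_mass_def using ram_moment_0(1)[of c] qpoch_inf_pos[OF q, of q] q by simp

section \<open>The pairing of the rational functions\<close>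

text \<open>The factors \<open>(1 - q) (q; q)_inf\<close> from the Gamma quotient cancel those left
  over from the three q-gamma functions.\<close>

lemma mu_density_eq:
  "mu_density \<alpha> \<beta> c q t
    = qpoch_inf (q powr (\<alpha> + 1)) q * qpoch_inf (q powr (\<beta> + 1)) q / qpoch_inf (q powr (\<alpha> + \<beta> + 2)) q
      / ram_mass q c
      * (ram_weight c q t * (qpoch_inf (- t * q powr (\<beta> + 1)) q * qpoch_inf (- (1 / t) * q powr (\<alpha> + 2)) q))"
proof -
  have "0 < qpoch_inf q q" by (intro qpoch_inf_pos q)
  have e: "1 - (\<alpha> + \<beta> + 2) = (1 - (\<alpha> + 1)) + (1 - (\<beta> + 1)) - 1" by simp
  have "(1 - q) powr (x + y - 1) = (1 - q) powr x * (1 - q) powr y / (1 - q)" for x y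
    using q by (simp add: powr_add powr_diff)
  then have pw: "(1 - q) powr (1 - (\<alpha> + \<beta> + 2))
      = (1 - q) powr (1 - (\<alpha> + 1)) * (1 - q) powr (1 - (\<beta> + 1)) / (1 - q)"
    unfolding e .
  have "q powr (- (c\<^sup>2)) * Gamma_quot q c = (1 - q) * qpoch_inf q q / ram_mass q c"
    using ram_moment_0(1)[of c] q \<open>0 < qpoch_inf q q\<close>
    unfolding ram_mass_def by (simp add: powr_minus field_simps)
  moreover have "Gamma_q q (\<alpha> + \<beta> + 2) / (Gamma_q q (\<alpha> + 1) * Gamma_q q (\<beta> + 1))
      = qpoch_inf (q powr (\<alpha> + 1)) q * qpoch_inf (q powr (\<beta> + 1)) q
        / (qpoch_inf (q powr (\<alpha> + \<beta> + 2)) q * qpoch_inf q q * (1 - q))"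
    unfolding Gamma_q_def pw using q \<open>0 < qpoch_inf q q\<close> by simp
  ultimately have "q powr (- (c\<^sup>2)) * Gamma_quot q c * Gamma_q q (\<alpha> + \<beta> + 2)
       / (Gamma_q q (\<alpha> + 1) * Gamma_q q (\<beta> + 1))
     = (1 - q) * qpoch_inf q q / ram_mass q c * (qpoch_inf (q powr (\<alpha> + 1)) q * qpoch_inf (q powr (\<beta> + 1)) q
        / (qpoch_inf (q powr (\<alpha> + \<beta> + 2)) q * qpoch_inf q q * (1 - q)))"
    by (metis times_divide_eq_right)
  also have "\<dots> = qpoch_inf (q powr (\<alpha> + 1)) q * qpoch_inf (q powr (\<beta> + 1)) q
     / qpoch_inf (q powr (\<alpha> + \<beta> + 2)) q / ram_mass q c"
    using q \<open>0 < qpoch_inf q q\<close> by (simp add: mult_ac)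
  finally show ?thesis unfolding mu_density_def ram_weight_def by (simp add: mult_ac)
qed

text \<open>The series terminates because \<open>(q^(-n); q)_j\<close> contains the factor
  \<open>1 - q^(-n) q^n\<close> as soon as \<open>j > n\<close>.\<close>

lemma p_rat_eq:
  "p_rat n \<alpha> \<beta> t q = (\<Sum>j\<le>n. p_coeff q n \<alpha> \<beta> j * t ^ j / qpoch (- t * q powr (\<beta> + 1)) q j)"
proof -
  have 0: "qpoch (q powr (- real n)) q j = 0" if "j \<notin> {..n}" for j
    using that q by (intro qpoch_eq_0[of n]) (auto simp: powr_realpow[symmetric] powr_add[symmetric])
  show ?thesis
    unfolding p_rat_def phi_2_2_def
    by (subst suminf_finite[of "{..n}"])
       (auto simp: 0 p_coeff_def mult_ac power_mult_distrib power_minus[of "q * t"] power_mult[symmetric]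
          mult_2_right[symmetric] intro!: sum.cong)
qed

text \<open>The finite denominators cancel the first \<open>j\<close> and \<open>k\<close> factors
  of the infinite products, so the term is a constant times the integrand of
  \<open>nn_integral_ram_weight\<close> with \<open>s = j - k\<close>,
  \<open>a = \<alpha> + 1 + k\<close>, \<open>b = \<beta> + 1 + j\<close>. The conditions become
  \<open>\<alpha> + 1 + j > 0\<close> and \<open>\<beta> + 1 + k > 0\<close>, and nonnegativity
  turns the integral in \<open>ennreal\<close> into integrability.\<close>

lemma has_bochner_integral_term:
  assumes ab: "\<alpha> > -1" "\<beta> > -1"
  shows "has_bochner_integral lpos
     (\<lambda>t. mu_density \<alpha> \<beta> c q t * (t ^ j / qpoch (- t * q powr (\<beta> + 1)) q j
        * ((1 / t * q) ^ k / qpoch (- (1 / t * q) * q powr (\<alpha> + 1)) q k)))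
     (q ^ k * q powr (- ((real j - real k) * (real j - real k - 1) / 2))
       * qpoch (q powr (\<alpha> + 1)) q j * qpoch (q powr (\<beta> + 1)) q k / qpoch (q powr (\<alpha> + \<beta> + 2)) q (j + k))"
proof -
  note [measurable] = borel_measurable_qpoch_inf[OF q]
  define s where "s = real_of_int (int j - int k)"
  have s: "s = real j - real k" by (simp add: s_def)
  define A B C where "A = qpoch_inf (q powr (\<alpha> + 1)) q" "B = qpoch_inf (q powr (\<beta> + 1)) q"
    "C = qpoch_inf (q powr (\<alpha> + \<beta> + 2)) q"
  define A' B' C' where "A' = qpoch_inf (q powr (\<alpha> + 1 + j)) q" "B' = qpoch_inf (q powr (\<beta> + 1 + k)) q"
    "C' = qpoch_inf (q powr (\<alpha> + \<beta> + 2 + (j + k))) q"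
  have pos': "0 < A" "0 < B" "0 < C" "0 < A'" "0 < B'" "0 < C'"
    unfolding A_B_C_def A'_B'_C'_def using ab by (auto intro!: qpoch_inf_powr_pos)
  have split: "qpoch_inf (q powr x) q = qpoch (q powr x) q n * qpoch_inf (q powr (x + real n)) q" for x n
    using qpoch_inf_split[OF q, of "q powr x" n] q by (simp add: powr_add powr_realpow)
  have ABC: "A = qpoch (q powr (\<alpha> + 1)) q j * A'" "B = qpoch (q powr (\<beta> + 1)) q k * B'"
    "C = qpoch (q powr (\<alpha> + \<beta> + 2)) q (j + k) * C'"
    unfolding A_B_C_def A'_B'_C'_def using split[of "\<alpha> + 1" j] split[of "\<beta> + 1" k] split[of "\<alpha> + \<beta> + 2" "j + k"] by simp_all
  note m = ram_mass_pos[of c]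
  define G where "G t = t powr s * ram_weight c q t
     * (qpoch_inf (- t * q powr (\<beta> + 1 + j)) q * qpoch_inf (- (1 / t) * q powr (\<alpha> + 1 + k + 1)) q)" for t
  have "has_bochner_integral lpos G (ram_mass q c * (q powr (- (s * (s - 1) / 2)) * C' / (A' * B')))"
  proof (rule has_bochner_integral_nn_integral)
    show "G \<in> borel_measurable lpos"
      unfolding G_def by (intro borel_measurable_lpos) measurable
    show "AE t in lpos. 0 \<le> G t"
      unfolding G_def
      by (intro AE_I2 mult_nonneg_nonneg less_imp_le[OF ram_weight_pos] less_imp_le[OF qpoch_inf_neg_pos]
           less_imp_le[OF qpoch_inf_neg_inverse_pos]) auto
    show "0 \<le> ram_mass q c * (q powr (- (s * (s - 1) / 2)) * C' / (A' * B'))"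
      using pos' m by simp
    have "(\<integral>\<^sup>+t. ennreal (G t) \<partial>lpos) = ram_moment c q 0 *
       ennreal (q powr (- (s * (s - 1) / 2)) * C' / (A' * B'))"
      using nn_integral_ram_weight[of "\<alpha> + 1 + k" "int j - int k" "\<beta> + 1 + j" c] ab
      unfolding G_def A'_B'_C'_def s_def by (simp add: algebra_simps)
    then show "(\<integral>\<^sup>+t. ennreal (G t) \<partial>lpos)
       = ennreal (ram_mass q c * (q powr (- (s * (s - 1) / 2)) * C' / (A' * B')))"
      by (simp only: ram_moment_0(2) ennreal_mult'[OF less_imp_le[OF m]])
  qed
  then have "has_bochner_integral lpos (\<lambda>t. (A * B / C / ram_mass q c * q ^ k) * G t)
     ((A * B / C / ram_mass q c * q ^ k) * (ram_mass q c * (q powr (- (s * (s - 1) / 2)) * C' / (A' * B'))))"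
    by (rule has_bochner_integral_mult_right)
  also have "(A * B / C / ram_mass q c * q ^ k) * (ram_mass q c * (q powr (- (s * (s - 1) / 2)) * C' / (A' * B')))
    = q ^ k * q powr (- ((real j - real k) * (real j - real k - 1) / 2))
       * qpoch (q powr (\<alpha> + 1)) q j * qpoch (q powr (\<beta> + 1)) q k / qpoch (q powr (\<alpha> + \<beta> + 2)) q (j + k)"
    unfolding ABC using pos' m by (simp add: s)
  also have "has_bochner_integral lpos (\<lambda>t. (A * B / C / ram_mass q c * q ^ k) * G t) = has_bochner_integral lpos
     (\<lambda>t. mu_density \<alpha> \<beta> c q t * (t ^ j / qpoch (- t * q powr (\<beta> + 1)) q j
        * ((1 / t * q) ^ k / qpoch (- (1 / t * q) * q powr (\<alpha> + 1)) q k)))"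
  proof (rule ext, rule has_bochner_integral_cong[OF refl _ refl])
    fix t assume "t \<in> space lpos"
    then have t: "0 < t" by simp
    define P Q where "P = qpoch (- t * q powr (\<beta> + 1)) q j" "Q = qpoch (- (1 / t * q) * q powr (\<alpha> + 1)) q k"
    define P' Q' where "P' = qpoch_inf (- t * q powr (\<beta> + 1 + j)) q" "Q' = qpoch_inf (- (1 / t) * q powr (\<alpha> + 1 + k + 1)) q"
    have e: "- (1 / t * q) * q powr (\<alpha> + 1) = - (1 / t) * q powr (\<alpha> + 2)"
      using q by (simp add: powr_add field_simps power2_eq_square)
    have P: "qpoch_inf (- t * q powr (\<beta> + 1)) q = P * P'"
      unfolding P_Q_def P'_Q'_def using qpoch_inf_split[OF q, of "- t * q powr (\<beta> + 1)" j] q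
      by (simp add: powr_add powr_realpow mult_ac)
    have e2: "\<alpha> + 1 + real k + 1 = \<alpha> + 2 + real k" by simp
    have Q: "qpoch_inf (- (1 / t) * q powr (\<alpha> + 2)) q = Q * Q'"
      unfolding P_Q_def P'_Q'_def e e2 using qpoch_inf_split[OF q, of "- (1 / t) * q powr (\<alpha> + 2)" k] q
      by (simp add: powr_add powr_realpow mult_ac)
    have "0 < P * P'" "0 < Q * Q'"
      unfolding P[symmetric] Q[symmetric] by (intro qpoch_inf_neg_pos qpoch_inf_neg_inverse_pos t)+
    then have "P \<noteq> 0" "Q \<noteq> 0" by auto
    have tp: "t powr s * q ^ k = t ^ j * (1 / t * q) ^ k"
      unfolding s using t by (simp add: powr_diff powr_realpow power_divide)
    have "(A * B / C / ram_mass q c * q ^ k) * G t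
       = A * B / C / ram_mass q c * (ram_weight c q t * (P' * Q')) * (t powr s * q ^ k)"
      unfolding G_def P'_Q'_def by (simp add: mult_ac)
    also have "\<dots> = A * B / C / ram_mass q c * (ram_weight c q t * ((P * P') * (Q * Q')))
        * (t ^ j / P * ((1 / t * q) ^ k / Q))"
      unfolding tp using \<open>P \<noteq> 0\<close> \<open>Q \<noteq> 0\<close> by simp
    also have "\<dots> = mu_density \<alpha> \<beta> c q t * (t ^ j / P * ((1 / t * q) ^ k / Q))"
      unfolding mu_density_eq P Q A_B_C_def ..
    finally show "(A * B / C / ram_mass q c * q ^ k) * G t
      = mu_density \<alpha> \<beta> c q t * (t ^ j / qpoch (- t * q powr (\<beta> + 1)) q j
        * ((1 / t * q) ^ k / qpoch (- (1 / t * q) * q powr (\<alpha> + 1)) q k))"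
      unfolding P_Q_def .
  qed
  finally show ?thesis .
qed

text \<open>The squares in the exponents cancel and leave \<open>j k + j + k\<close>. The factors
  \<open>(q^(\<alpha>+1); q)_j\<close> and \<open>(q^(\<beta>+1); q)_k\<close> cancel too, so the
  double sum depends on \<open>\<alpha>\<close> and \<open>\<beta>\<close> only through their
  sum.\<close>

lemma coeff_product:
  assumes ab: "\<alpha> > -1" "\<beta> > -1"
  shows "p_coeff q n \<alpha> \<beta> j * p_coeff q m \<beta> \<alpha> k
     * (q ^ k * q powr (- ((real j - real k) * (real j - real k - 1) / 2))
       * qpoch (q powr (\<alpha> + 1)) q j * qpoch (q powr (\<beta> + 1)) q k / qpoch (q powr (\<alpha> + \<beta> + 2)) q (j + k))
   = qpoch (q powr (- real n)) q j * qpoch (q powr (real n + (\<alpha> + \<beta> + 2) - 1)) q j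
            * qpoch (q powr (- real m)) q k * qpoch (q powr (real m + (\<alpha> + \<beta> + 2) - 1)) q k
            / (qpoch q q j * qpoch q q k * qpoch (q powr (\<alpha> + \<beta> + 2)) q (j + k)) * q ^ (j * k + j + k)"
proof -
  have nz: "qpoch (q powr (\<alpha> + 1)) q j \<noteq> 0" "qpoch (q powr (\<beta> + 1)) q k \<noteq> 0"
    using qpoch_pos[OF q powr_less_one_of_pos, of "\<alpha> + 1" j] qpoch_pos[OF q powr_less_one_of_pos, of "\<beta> + 1" k] ab by auto
  have tri: "real (i * (i - 1) div 2) = real i * (real i - 1) / 2" for i :: nat
    by (cases i) (auto simp: real_of_nat_div algebra_simps)
  have pw: "q ^ (j * (j - 1) div 2) * q ^ j * (q ^ (k * (k - 1) div 2) * q ^ k)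
      * (q ^ k * q powr (- ((real j - real k) * (real j - real k - 1) / 2))) = q ^ (j * k + j + k)"
    unfolding powr_realpow[OF q(1), symmetric] powr_add[symmetric] tri
    by (rule arg_cong[where f = "(powr) q"]) (simp add: field_simps)
  have "x1 / (a * y1) * w1 * w2 * (x2 / (b * y2) * w3 * w4) * (w5 * w6 * a * b / z)
      = x1 * x2 / (y1 * y2 * z) * (w1 * w2 * (w3 * w4) * (w5 * w6))" if "a \<noteq> 0" "b \<noteq> 0"
      for x1 x2 a b y1 y2 w1 w2 w3 w4 w5 w6 z :: real
    using that by simp
  from this[OF nz] have "p_coeff q n \<alpha> \<beta> j * p_coeff q m \<beta> \<alpha> k
     * (q ^ k * q powr (- ((real j - real k) * (real j - real k - 1) / 2))
       * qpoch (q powr (\<alpha> + 1)) q j * qpoch (q powr (\<beta> + 1)) q k / qpoch (q powr (\<alpha> + \<beta> + 2)) q (j + k))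
     = (qpoch (q powr (- real n)) q j * qpoch (q powr (real n + \<alpha> + \<beta> + 1)) q j)
       * (qpoch (q powr (- real m)) q k * qpoch (q powr (real m + \<beta> + \<alpha> + 1)) q k)
       / (qpoch q q j * qpoch q q k * qpoch (q powr (\<alpha> + \<beta> + 2)) q (j + k)) * q ^ (j * k + j + k)"
    unfolding p_coeff_def pw[symmetric] by blast
  moreover have "real n + \<alpha> + \<beta> + 1 = real n + (\<alpha> + \<beta> + 2) - 1" "real m + \<beta> + \<alpha> + 1 = real m + (\<alpha> + \<beta> + 2) - 1"
    by simp_all
  ultimately show ?thesis by (simp only: mult.assoc)
qed

lemma has_bochner_integral_mu_rat:
  assumes ab: "\<alpha> > -1" "\<beta> > -1"
    and f: "f \<in> borel_measurable borel"
    and int: "has_bochner_integral lpos (\<lambda>t. mu_density \<alpha> \<beta> c q t * f t) I"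
  shows "has_bochner_integral (mu_rat \<alpha> \<beta> c q) f I"
  unfolding mu_rat_def
proof (rule has_bochner_integral_density)
  note [measurable] = borel_measurable_qpoch_inf[OF q]
  show "f \<in> borel_measurable (restrict_space lborel {0..})"
    by (intro measurable_restrict_space1) (use f in simp)
  show "mu_density \<alpha> \<beta> c q \<in> borel_measurable (restrict_space lborel {0..})"
    unfolding mu_density_eq[abs_def] by (intro measurable_restrict_space1) measurable
  \<comment> \<open>By the convention \<open>0 powr x = 0\<close>. Hence the integrands over the
    open and the closed half-line agree at every point.\<close>
  have z: "mu_density \<alpha> \<beta> c q 0 = 0"
    by (simp add: mu_density_def)
  show "AE t in restrict_space lborel {0..}. 0 \<le> mu_density \<alpha> \<beta> c q t"
  proof (rule AE_I2)
    fix t :: real assume "t \<in> space (restrict_space lborel {0..})"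
    then consider "t = 0" | "0 < t" by (cases "t = 0") (auto simp: space_restrict_space less_le)
    then show "0 \<le> mu_density \<alpha> \<beta> c q t"
    proof cases
      case 2
      show ?thesis unfolding mu_density_eq
        using 2 ab ram_mass_pos[of c] qpoch_inf_powr_pos[of "\<alpha> + 1"] qpoch_inf_powr_pos[of "\<beta> + 1"]
          qpoch_inf_powr_pos[of "\<alpha> + \<beta> + 2"]
          ram_weight_pos[of t c] qpoch_inf_neg_pos[of t] qpoch_inf_neg_inverse_pos[of t]
        by (intro mult_nonneg_nonneg divide_nonneg_nonneg) (auto intro: less_imp_le)
    qed (simp add: z)
  qed
  have "has_bochner_integral lborel (\<lambda>t. indicator {0<..} t *\<^sub>R (mu_density \<alpha> \<beta> c q t * f t)) I"
    using int by (subst (asm) has_bochner_integral_restrict_space) auto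
  also have "(\<lambda>t. indicator {0<..} t *\<^sub>R (mu_density \<alpha> \<beta> c q t * f t))
     = (\<lambda>t. indicator {0..} t *\<^sub>R (mu_density \<alpha> \<beta> c q t *\<^sub>R f t))"
    using z by (auto simp: indicator_def fun_eq_iff less_le)
  finally show "has_bochner_integral (restrict_space lborel {0..}) (\<lambda>t. mu_density \<alpha> \<beta> c q t *\<^sub>R f t) I"
    by (subst has_bochner_integral_restrict_space) auto
qed

end

theorem theorem1p2:
  fixes q \<alpha> \<beta> c :: real and n m :: nat
  assumes "0 < q" and "q < 1" and "\<alpha> > -1" and "\<beta> > -1"
  shows "has_bochner_integral (mu_rat \<alpha> \<beta> c q)
           (\<lambda>t. p_rat n \<alpha> \<beta> t q * p_rat m \<beta> \<alpha> ((1 / t) * q) q)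
           ((-1) ^ n
              * (if n = 0 then 1
                 else (1 - q powr (real n + \<alpha> + \<beta> + 1)) / (1 - q powr (2 * real n + \<alpha> + \<beta> + 1)))
              * qpoch q q n * (if n = m then 1 else 0)
            / (q ^ (n * (n - 1) div 2) * qpoch (q powr (\<alpha> + \<beta> + 2)) q n))"
proof (rule has_bochner_integral_mu_rat[OF assms])
  note q = assms(1,2) and ab = assms(3,4)
  note p = p_rat_eq[OF q]
  show "(\<lambda>t. p_rat n \<alpha> \<beta> t q * p_rat m \<beta> \<alpha> ((1 / t) * q) q) \<in> borel_measurable borel"
    unfolding p qpoch_def by measurable
  define C where "C j k = p_coeff q n \<alpha> \<beta> j * p_coeff q m \<beta> \<alpha> k" for j k
  define V where "V j k = q ^ k * q powr (- ((real j - real k) * (real j - real k - 1) / 2))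
       * qpoch (q powr (\<alpha> + 1)) q j * qpoch (q powr (\<beta> + 1)) q k / qpoch (q powr (\<alpha> + \<beta> + 2)) q (j + k)" for j k
  define F where "F j k t = mu_density \<alpha> \<beta> c q t * (t ^ j / qpoch (- t * q powr (\<beta> + 1)) q j
        * ((1 / t * q) ^ k / qpoch (- (1 / t * q) * q powr (\<alpha> + 1)) q k))" for j k t
  \<comment> \<open>Each \<open>F j k\<close> is integrable by itself, so linearity gives
    integrability and value of the whole pairing together.\<close>
  have "has_bochner_integral lpos (\<lambda>t. \<Sum>j\<le>n. \<Sum>k\<le>m. C j k * F j k t) (\<Sum>j\<le>n. \<Sum>k\<le>m. C j k * V j k)"
    unfolding F_def V_def
    by (intro has_bochner_integral_sum has_bochner_integral_mult_right has_bochner_integral_term q ab)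
  also have "(\<lambda>t. \<Sum>j\<le>n. \<Sum>k\<le>m. C j k * F j k t)
      = (\<lambda>t. mu_density \<alpha> \<beta> c q t * (p_rat n \<alpha> \<beta> t q * p_rat m \<beta> \<alpha> ((1 / t) * q) q))"
    unfolding p sum_product unfolding sum_distrib_left
    by (intro ext sum.cong refl) (simp add: C_def F_def)
  also have "(\<Sum>j\<le>n. \<Sum>k\<le>m. C j k * V j k)
     = (if n = m then (-1) ^ n * (if n = 0 then 1
                 else (1 - q powr (real n + (\<alpha> + \<beta> + 2) - 1)) / (1 - q powr (2 * real n + (\<alpha> + \<beta> + 2) - 1)))
              * qpoch q q n / (q ^ (n * (n - 1) div 2) * qpoch (q powr (\<alpha> + \<beta> + 2)) q n) else 0)"
    unfolding C_def V_def coeff_product[OF q ab] by (rule orthogonality_sum[OF q]) (use ab in simp)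
  also have "real n + (\<alpha> + \<beta> + 2) - 1 = real n + \<alpha> + \<beta> + 1" by simp
  also have "2 * real n + (\<alpha> + \<beta> + 2) - 1 = 2 * real n + \<alpha> + \<beta> + 1" by simp
  finally show "has_bochner_integral lpos
     (\<lambda>t. mu_density \<alpha> \<beta> c q t * (p_rat n \<alpha> \<beta> t q * p_rat m \<beta> \<alpha> ((1 / t) * q) q))
     ((-1) ^ n
              * (if n = 0 then 1
                 else (1 - q powr (real n + \<alpha> + \<beta> + 1)) / (1 - q powr (2 * real n + \<alpha> + \<beta> + 1)))
              * qpoch q q n * (if n = m then 1 else 0)
            / (q ^ (n * (n - 1) div 2) * qpoch (q powr (\<alpha> + \<beta> + 2)) q n))"
    by (cases "n = m") simp_all
qed

end
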